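(* Let $a,d,c$ be positive integers and $k\ge2$ an integer with $\gcd(a,a+d,\ldots,a+kd,c)=1$, and let $\mathcal{S}=\langle a,a+d,\ldots,a+kd,c\rangle$. Then $\mathcal{S}$ is pseudo-symmetric if and only if $\gcd(a,d)=1$ and one of the following holds: (a) $\mathcal{S}=\langle 3,3+d,3+2d\rangle$ (as sets); (b) $a(c-1)=2(c+d)$ and $c$ is odd; (c) $s_v\equiv3\pmod k$, $s_{v+1}=1$, $P_{v+1}=P_v+1$ and $R_v=3$; (d) $s_v\equiv1\pmod k$, $s_{v+1}=2k-1$, $P_{v+1}=P_v+1$ and $R_v=1$; (e) $s_0\equiv2\pmod k$, $s_0=s_1+1$ and $R_1=1-2k$; (f) $s_0\equiv2\pmod k$, $s_0=s_1+3$ and $R_1=-1$.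
   Context: $\langle b_1,\ldots,b_t\rangle$ denotes the numerical semigroup of non-negative integer combinations of $b_1,\ldots,b_t$. For a numerical semigroup $\mathcal{S}$ with Frobenius number $g$ (largest integer not in $\mathcal{S}$), $\mathcal{S}$ is pseudo-symmetric if $g$ is even and $\mathcal{S}\cup(g-\mathcal{S})=\mathbb{Z}\setminus\{g/2\}$, where $g-\mathcal{S}=\{g-s:s\in\mathcal{S}\}$. When $\gcd(a,d)=1$ the following quantities are defined. Put $s_{-1}=a$ and let $s_0$ be the unique integer with $ds_0\equiv c\pmod a$, $0\le s_0<a$. If $s_0=0$ set $m=-1$. Otherwise define $q_{i+1},s_{i+1}$ for $i=0,1,2,\ldots$ by $s_{i-1}=q_{i+1}s_i-s_{i+1}$ with $0\le s_{i+1}<s_i$, and let $m$ be the index with $s_m>0=s_{m+1}$ (so $s_m=\gcd(a,c)$). Define $P_{-1}=0$, $P_0=1$, $P_{i+1}=q_{i+1}P_i-P_{i-1}$ for $i=0,\ldots,m$, and $R_i=\frac1a\big((a+kd)s_i-kcP_i\big)$ for $-1\le i\le m+1$; these are integers with $-c/s_m=R_{m+1}<R_m<\cdots<R_0<R_{-1}=a+kd$. Let $v$ be the unique integer with $R_{v+1}\le0<R_v$. (Here $s_1,R_1$ refer to these sequences; when they are not defined, e.g. $m<0$, the corresponding condition is understood to fail.) *)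

theory Defs
  imports "HOL-Number_Theory.Cong"
begin

inductive_set semigroup_gen :: "int set \<Rightarrow> int set" for B :: "int set" where
  zero: "0 \<in> semigroup_gen B"
| add: "x \<in> semigroup_gen B \<Longrightarrow> b \<in> B \<Longrightarrow> x + b \<in> semigroup_gen B"

definition frobenius :: "int set \<Rightarrow> int" where
  "frobenius S = (GREATEST x. x \<notin> S)"

definition pseudo_symmetric :: "int set \<Rightarrow> bool" where
  "pseudo_symmetric S \<longleftrightarrow>
     (let g = frobenius S in
        even g \<and> S \<union> {g - x | x. x \<in> S} = UNIV - {g div 2})"

definition s0_of :: "int \<Rightarrow> int \<Rightarrow> int \<Rightarrow> int" where
  "s0_of a d c = (THE x. 0 \<le> x \<and> x < a \<and> [d * x = c] (mod a))"

text \<open>Step n gives ((s_{n-1}, s_n), (P_{n-1}, P_n)).  The quotient q_{i+1} is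
ceiling(s_{i-1}/s_i), i.e. the unique q with s_{i+1} = q s_i - s_{i-1} in [0, s_i).
After s becomes 0 the sequence s is continued by 0 (values beyond index m+1 are
never used).\<close>
fun sP_step :: "int \<Rightarrow> int \<Rightarrow> nat \<Rightarrow> (int \<times> int) \<times> (int \<times> int)" where
  "sP_step a s0 0 = ((a, s0), (0, 1))"
| "sP_step a s0 (Suc n) =
     (let ((u, v), (p, p')) = sP_step a s0 n;
          q = (if v = 0 then 0 else - ((- u) div v))
      in ((v, if v = 0 then 0 else q * v - u), (p', q * p' - p)))"

definition s_seq :: "int \<Rightarrow> int \<Rightarrow> int \<Rightarrow> int \<Rightarrow> int" where
  "s_seq a d c i = fst (fst (sP_step a (s0_of a d c) (nat (i + 1))))"

definition P_seq :: "int \<Rightarrow> int \<Rightarrow> int \<Rightarrow> int \<Rightarrow> int" where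
  "P_seq a d c i = fst (snd (sP_step a (s0_of a d c) (nat (i + 1))))"

definition m_idx :: "int \<Rightarrow> int \<Rightarrow> int \<Rightarrow> int" where
  "m_idx a d c = (THE m. -1 \<le> m \<and> s_seq a d c (m + 1) = 0 \<and>
                     (\<forall>i. -1 \<le> i \<and> i \<le> m \<longrightarrow> s_seq a d c i > 0))"

text \<open>R_i = ((a + k d) s_i - k c P_i) / a (an integer).\<close>
definition R_seq :: "int \<Rightarrow> int \<Rightarrow> int \<Rightarrow> int \<Rightarrow> int \<Rightarrow> int" where
  "R_seq a d c k i = ((a + k * d) * s_seq a d c i - k * c * P_seq a d c i) div a"

definition v_idx :: "int \<Rightarrow> int \<Rightarrow> int \<Rightarrow> int \<Rightarrow> int" where
  "v_idx a d c k = (THE v. -1 \<le> v \<and> v \<le> m_idx a d c \<and>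
                       R_seq a d c k (v + 1) \<le> 0 \<and> 0 < R_seq a d c k v)"

end

theory Submission
  imports Defs
begin

text \<open>
  Elements of the semigroup are the numbers \<open>a * t + d * y + c * z\<close> with \<open>0 \<le> y \<le> k * t\<close> and
  \<open>0 \<le> z\<close>.  If \<open>gcd a d = h > 1\<close>, the semigroup is glued from \<open>h\<close> translates of one semigroup,
  so the integers \<open>n\<close> with neither \<open>n\<close> nor \<open>g - n\<close> in it never form a singleton.

  If \<open>a\<close> and \<open>d\<close> are coprime, Rodseth's continued fraction gives an L-shaped set of exactly \<open>a\<close>
  pairs \<open>(y, z)\<close> which represent the Apery set with respect to \<open>a\<close>.  The largest Apery
  element sits at one of the two outer corners of this shape.  Reflection in that corner maps the
  rectangle below the corner to itself, and also the remaining part of the shape after a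
  translation by a lattice relation.  The semigroup is pseudo-symmetric iff
  \<open>\<lceil>y/k\<rceil> + \<lceil>y'/k\<rceil>\<close> fails to add up under this reflection at exactly one pair, and there by exactly one.
  In each part the failure does not depend on \<open>z\<close>, which leaves one-dimensional conditions
  modulo \<open>k\<close>.
\<close>

subsection \<open>Semigroups generated by almost arithmetic sequences\<close>

abbreviation almost_arith :: "int \<Rightarrow> int \<Rightarrow> int \<Rightarrow> int \<Rightarrow> int set" where
  "almost_arith a d c k \<equiv> semigroup_gen (insert c {a + j * d | j. 0 \<le> j \<and> j \<le> k})"

lemma semigroup_gen_add:
  assumes "x \<in> semigroup_gen B" "y \<in> semigroup_gen B"
  shows "x + y \<in> semigroup_gen B"
  using assms(2)
proof induction
  case zero
  then show ?case using assms(1) by simp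
next
  case (add y b)
  then show ?case using semigroup_gen.add[of "x + y" B b] by (simp add: add.assoc)
qed

lemma semigroup_gen_mult:
  assumes "b \<in> B" shows "int n * b \<in> semigroup_gen B"
proof (induction n)
  case 0
  then show ?case by (simp add: semigroup_gen.zero)
next
  case (Suc n)
  then show ?case using semigroup_gen.add[OF Suc assms] by (simp add: algebra_simps)
qed

text \<open>Here \<open>t\<close> counts the generators taken from the progression, \<open>y\<close>
  is the sum of their indices \<open>j\<close>, and \<open>z\<close> counts copies of
  \<open>c\<close>. Conversely \<open>y\<close> is split into \<open>t\<close> indices by peeling
  off \<open>min y k\<close> greedily.\<close>

lemma almost_arith_iff:
  assumes "k \<ge> 0"
  shows "n \<in> almost_arith a d c k \<longleftrightarrow>
    (\<exists>t y z. 0 \<le> y \<and> y \<le> k * t \<and> 0 \<le> t \<and> 0 \<le> z \<and> n = a * t + d * y + c * z)"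
proof
  assume "n \<in> almost_arith a d c k"
  then show "\<exists>t y z. 0 \<le> y \<and> y \<le> k * t \<and> 0 \<le> t \<and> 0 \<le> z \<and> n = a * t + d * y + c * z"
  proof induction
    case zero
    show ?case by (intro exI[of _ 0]) simp
  next
    case (add x b)
    then obtain t y z where *: "0 \<le> y" "y \<le> k * t" "0 \<le> t" "0 \<le> z" "x = a * t + d * y + c * z"
      by blast
    from add(2) consider "b = c" | j where "0 \<le> j" "j \<le> k" "b = a + j * d" by blast
    then show ?case
    proof cases
      case 1
      then show ?thesis using * by (intro exI[of _ t] exI[of _ y] exI[of _ "z + 1"]) (auto simp: algebra_simps)
    next
      case 2
      then show ?thesis using *
        by (intro exI[of _ "t + 1"] exI[of _ "y + j"] exI[of _ z]) (auto simp: algebra_simps)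
    qed
  qed
next
  let ?S = "almost_arith a d c k"
  assume "\<exists>t y z. 0 \<le> y \<and> y \<le> k * t \<and> 0 \<le> t \<and> 0 \<le> z \<and> n = a * t + d * y + c * z"
  then obtain t y z where *: "0 \<le> y" "y \<le> k * t" "0 \<le> t" "0 \<le> z" "n = a * t + d * y + c * z"
    by blast
  have ap: "0 \<le> y \<Longrightarrow> y \<le> k * int m \<Longrightarrow> a * int m + d * y \<in> ?S" for m y
  proof (induction m arbitrary: y)
    case 0
    then show ?case by (simp add: semigroup_gen.zero)
  next
    case (Suc m)
    define j where "j = min y k"
    have "a * int m + d * (y - j) \<in> ?S"
      using Suc.prems assms by (intro Suc.IH) (auto simp: j_def min_def algebra_simps)
    moreover have "a + j * d \<in> insert c {a + j * d | j. 0 \<le> j \<and> j \<le> k}"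
      using Suc.prems assms by (auto simp: j_def)
    ultimately have "a * int m + d * (y - j) + (a + j * d) \<in> ?S" by (rule semigroup_gen.add)
    then show ?case by (simp add: algebra_simps)
  qed
  have "a * t + d * y \<in> ?S" using ap[of y "nat t"] * by simp
  moreover have "c * z \<in> ?S"
    using semigroup_gen_mult[of c "insert c {a + j * d | j. 0 \<le> j \<and> j \<le> k}" "nat z"] *
    by (simp add: mult.commute)
  ultimately show "n \<in> ?S" using semigroup_gen_add[of "a * t + d * y" _ "c * z"] *(5) by simp
qed

lemma almost_arith_3: "almost_arith 3 d 3 2 = semigroup_gen {3, 3 + d, 3 + 2 * d}"
proof -
  have "0 \<le> j \<and> j \<le> 2 \<longleftrightarrow> j = 0 \<or> j = 1 \<or> j = 2" for j :: int by auto
  then have "{3 + j * d | j. 0 \<le> j \<and> j \<le> 2} = {3, 3 + d, 3 + 2 * d}" by auto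
  then show ?thesis by (simp add: insert_absorb)
qed

lemma almost_arith_nonneg:
  assumes "a > 0" "d > 0" "c > 0" "k \<ge> 0" "n \<in> almost_arith a d c k"
  shows "n \<ge> 0"
proof -
  obtain t y z where "0 \<le> y" "0 \<le> t" "0 \<le> z" "n = a * t + d * y + c * z"
    using assms almost_arith_iff by blast
  then show ?thesis using assms by simp
qed

lemma coprime_solve:
  fixes a b n :: int
  assumes "coprime a b" "a > 0"
  obtains y t where "0 \<le> y" "y < a" "n = a * t + b * y"
proof -
  obtain x' where "[b * x' = 1] (mod a)"
    using cong_solve_coprime_int[of b a] assms(1) by (auto simp: coprime_commute)
  then have "[b * x' * n = 1 * n] (mod a)" by (rule cong_scalar_right)
  then obtain x where x: "[b * x = n] (mod a)" by (auto simp: mult.assoc)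
  define y where "y = x mod a"
  have "[b * y = n] (mod a)"
    using x unfolding y_def cong_def by (simp add: mod_mult_right_eq)
  then obtain t where "n = b * y + a * t" unfolding cong_iff_lin by blast
  then show ?thesis using that[of y t] assms(2) by (simp add: y_def)
qed

lemma coprime_almost_arith_cofinite:
  assumes "a > 0" "d > 0" "c > 0" "k \<ge> 1" "coprime a d"
  shows "\<exists>b. \<forall>n\<ge>b. n \<in> almost_arith a d c k"
proof (intro exI allI impI)
  fix n :: int
  \<comment> \<open>The bound forces \<open>t \<ge> a > y\<close> in the reduced solution, so
    \<open>y \<le> k * t\<close> with no copy of \<open>c\<close>.\<close>
  assume n: "a * a + d * a \<le> n"
  obtain y t where y: "0 \<le> y" "y < a" "n = a * t + d * y"
    using coprime_solve[OF assms(5,1)] .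
  have "d * y \<le> d * a" using y assms by simp
  then have "a * a \<le> a * t" using n y(3) by linarith
  then have t: "a \<le> t" using assms by simp
  have "1 * t \<le> k * t" using assms t by (intro mult_right_mono) auto
  then have "y \<le> k * t" using y t by linarith
  then have "0 \<le> y \<and> y \<le> k * t \<and> 0 \<le> t \<and> 0 \<le> (0::int) \<and> n = a * t + d * y + c * 0"
    using y t assms by simp
  then show "n \<in> almost_arith a d c k"
    using almost_arith_iff[of k] assms(4) by force
qed

subsection \<open>Frobenius numbers and pseudo-symmetry\<close>

lemma frobenius_eqI:
  assumes "g \<notin> S" "\<And>n. n > g \<Longrightarrow> n \<in> S"
  shows "frobenius S = g"
  unfolding frobenius_def using assms by (intro Greatest_equality) (auto intro: leI)

lemma frobenius_props:
  assumes "\<exists>b. \<forall>n\<ge>b. n \<in> S" "\<forall>n\<in>S. n \<ge> (0::int)"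
  shows "frobenius S \<notin> S" and "\<And>n. n > frobenius S \<Longrightarrow> n \<in> S"
proof -
  obtain b where b: "\<forall>n\<ge>b. n \<in> S" using assms by blast
  define M where "M = {n. -1 \<le> n \<and> n < b \<and> n \<notin> S}"
  have "finite M" by (rule finite_subset[of _ "{-1..b}"]) (auto simp: M_def)
  moreover have m1: "-1 \<notin> S" using assms(2) by force
  then have "-1 \<in> M" using b by (auto simp: M_def) (meson not_less)
  ultimately have "Max M \<in> M" and M: "\<And>n. n \<in> M \<Longrightarrow> n \<le> Max M" by (auto intro: Max_in)
  have notin: "Max M \<notin> S" using \<open>Max M \<in> M\<close> by (simp add: M_def)
  have above: "n \<in> S" if "n > Max M" for n
  proof (rule ccontr)
    assume n: "n \<notin> S"
    have "n \<ge> -1" using that M[OF \<open>-1 \<in> M\<close>] by simp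
    then have "n \<in> M" using n b by (auto simp: M_def) (meson not_less)
    then show False using M that by fastforce
  qed
  show "frobenius S \<notin> S" and "\<And>n. n > frobenius S \<Longrightarrow> n \<in> S"
    using frobenius_eqI[OF notin above] notin above by auto
qed

text \<open>As \<open>c\<close> is invertible modulo \<open>h\<close>, the multiplier of
  \<open>c\<close> has the form \<open>i + h * w\<close>, and its sign together with
  \<open>i < h\<close> forces \<open>w \<ge> 0\<close>.\<close>

lemma almost_arith_scaled_iff:
  assumes "coprime c h" "h > 0" "k \<ge> 0" "0 \<le> i" "i < h"
  shows "c * i + h * t \<in> almost_arith (h * a) (h * d) c k \<longleftrightarrow> t \<in> almost_arith a d c k"
proof
  assume "c * i + h * t \<in> almost_arith (h * a) (h * d) c k"
  then obtain t' y z where *: "0 \<le> y" "y \<le> k * t'" "0 \<le> t'" "0 \<le> z"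
    "c * i + h * t = h * a * t' + h * d * y + c * z"
    using almost_arith_iff[OF assms(3)] by blast
  have "c * (z - i) = h * (t - a * t' - d * y)" using *(5) by (simp add: algebra_simps)
  then have "h dvd c * (z - i)" by simp
  then have "h dvd z - i" using assms(1) by (simp add: coprime_commute coprime_dvd_mult_right_iff)
  then obtain w where w: "z - i = h * w" by blast
  have "w \<ge> 0"
  proof (rule ccontr)
    assume "\<not> w \<ge> 0"
    then have "h * w \<le> h * (-1)" using assms(2) by (intro mult_left_mono) auto
    then show False using w * assms by simp
  qed
  have "z = i + h * w" using w by simp
  then have "h * t = h * (a * t' + d * y + c * w)"
    using *(5) by (simp add: algebra_simps)
  then have "t = a * t' + d * y + c * w" using assms(2) by simp
  then show "t \<in> almost_arith a d c k" using * \<open>w \<ge> 0\<close> almost_arith_iff[OF assms(3)] by blast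
next
  assume "t \<in> almost_arith a d c k"
  then obtain t' y z where *: "0 \<le> y" "y \<le> k * t'" "0 \<le> t'" "0 \<le> z" "t = a * t' + d * y + c * z"
    using almost_arith_iff[OF assms(3)] by blast
  have "c * i + h * t = h * a * t' + h * d * y + c * (i + h * z)" using * by (simp add: algebra_simps)
  moreover have "i + h * z \<ge> 0" using * assms by simp
  ultimately show "c * i + h * t \<in> almost_arith (h * a) (h * d) c k"
    using * almost_arith_iff[OF assms(3)] by blast
qed

lemma pseudo_symmetric_unmatched:
  assumes "frobenius S = g"
  shows "pseudo_symmetric S \<longleftrightarrow> even g \<and> (\<forall>n. n \<notin> S \<and> g - n \<notin> S \<longleftrightarrow> n = g div 2)"
proof -
  have "n \<in> {g - x | x. x \<in> S} \<longleftrightarrow> g - n \<in> S" for n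
    by (auto intro!: exI[of _ "g - n"])
  then show ?thesis
    unfolding pseudo_symmetric_def Let_def assms set_eq_iff Un_iff Diff_iff by auto
qed

text \<open>For \<open>h = gcd a d > 1\<close> reflection sends \<open>c * l + h * u\<close> to
  \<open>c * (h - 1 - l) + h * (t - u)\<close>. Whether a number is unmatched then depends on
  \<open>u\<close> alone, so \<open>l = 0\<close> and \<open>l = 1\<close> give two unmatched
  numbers.\<close>

lemma almost_arith_pseudo_symmetric_coprime:
  assumes "a > 0" "d > 0" "c > 0" "k \<ge> 1" "coprime (gcd a d) c"
    and ps: "pseudo_symmetric (almost_arith a d c k)"
  shows "coprime a d"
proof (rule ccontr)
  assume "\<not> coprime a d"
  define h where "h = gcd a d"
  have "h > 0" using assms(1) by (simp add: h_def)
  moreover have "h \<noteq> 1" using \<open>\<not> coprime a d\<close> by (simp add: h_def coprime_iff_gcd_eq_1)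
  ultimately have h: "h > 1" by simp
  have "\<exists>a' d'. a = a' * h \<and> d = d' * h \<and> coprime a' d'"
    unfolding h_def using assms(1) by (intro gcd_coprime_exists) simp
  then obtain a' d' where ad: "a = h * a'" "d = h * d'" "coprime a' d'"
    by (auto simp: mult.commute)
  have pos: "a' > 0" "d' > 0" using ad assms h by (simp_all add: zero_less_mult_iff)
  let ?S = "almost_arith a d c k" and ?T = "almost_arith a' d' c k"
  have cop: "coprime c h" using assms(5) by (simp add: h_def coprime_commute)
  have sc: "c * i + h * t \<in> ?S \<longleftrightarrow> t \<in> ?T" if "0 \<le> i" "i < h" for i t
    using almost_arith_scaled_iff[of c h k i t a' d'] ad that cop h assms(4) by simp
  have rep: "\<exists>i t. 0 \<le> i \<and> i < h \<and> n = c * i + h * t" for n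
  proof -
    have "coprime h c" "h > 0" using cop h by (auto simp: coprime_commute)
    then obtain i t where "0 \<le> i" "i < h" "n = h * t + c * i" by (rule coprime_solve)
    then show ?thesis by (intro exI[of _ i] exI[of _ t]) simp
  qed
  obtain b where b: "\<forall>n\<ge>b. n \<in> ?T"
    using coprime_almost_arith_cofinite[of a' d' c k] pos ad assms by blast
  have cof: "n \<in> ?S" if n: "n \<ge> c * h + h * b" for n
  proof -
    obtain i t where it: "0 \<le> i" "i < h" "n = c * i + h * t" using rep by blast
    have "c * i \<le> c * h" using it assms by simp
    then have "h * b \<le> h * t" using n it by linarith
    then show ?thesis using sc it b h by simp
  qed
  define g where "g = frobenius ?S"
  have "\<exists>b. \<forall>n\<ge>b. n \<in> ?S" using cof by blast
  moreover have "\<forall>n\<in>?S. n \<ge> 0" using almost_arith_nonneg[of a d c k] assms by simp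
  ultimately have g: "g \<notin> ?S" "\<And>n. n > g \<Longrightarrow> n \<in> ?S"
    unfolding g_def by (rule frobenius_props)+
  obtain i t where it: "0 \<le> i" "i < h" "g = c * i + h * t" using rep by blast
  have "t \<notin> ?T" using g sc it by simp
  \<comment> \<open>Otherwise the same \<open>t\<close> in the last class would give a larger
    gap.\<close>
  have i: "i = h - 1"
  proof (rule ccontr)
    assume "i \<noteq> h - 1"
    then have "c * i < c * (h - 1)" using it assms by simp
    then have "c * (h - 1) + h * t > g" using it by simp
    then have "c * (h - 1) + h * t \<in> ?S" by (rule g(2))
    then show False using sc[of "h - 1" t] h \<open>t \<notin> ?T\<close> by simp
  qed
  have U: "even g" "\<And>n. n \<notin> ?S \<and> g - n \<notin> ?S \<longleftrightarrow> n = g div 2"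
    using ps pseudo_symmetric_unmatched[of ?S g] g_def by auto
  obtain j u where ju: "0 \<le> j" "j < h" "g div 2 = c * j + h * u" using rep by blast
  have refl: "g - (c * l + h * u) = c * (h - 1 - l) + h * (t - u)" for l
    using it i by (simp add: algebra_simps)
  have "u \<notin> ?T" using U(2)[of "g div 2"] ju sc by auto
  moreover have "t - u \<notin> ?T"
    using U(2)[of "g div 2"] ju sc[of "h - 1 - j" "t - u"] refl[of j] by auto
  ultimately have "c * l + h * u = g div 2" if "0 \<le> l" "l < h" for l
    using U(2)[of "c * l + h * u"] refl[of l] sc[of l u] sc[of "h - 1 - l" "t - u"] that by auto
  from this[of 0] this[of 1] show False using h assms by simp
qed

subsection \<open>The L-shaped Apery set\<close>

text \<open>The parameters \<open>s, s', P, P'\<close> are $s_v, s_{v+1}, P_v, P_{v+1}$; then \<open>s + k * \<tau>\<close> is $R_v$ and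
  \<open>k * \<tau>' - s'\<close> is $-R_{v+1}$.\<close>
locale rodseth_shape =
  fixes a d c k s s' P P' \<tau> \<tau>' :: int
  assumes a_pos: "a > 0" and d_pos: "d > 0" and c_pos: "c > 0" and k_ge: "k \<ge> 2"
    and cop: "coprime a d"
    and s'_nonneg: "0 \<le> s'" and s'_less: "s' < s" and P_nonneg: "0 \<le> P" and P_less: "P < P'"
    and det: "s * P' - s' * P = a"
    and rel: "d * s = c * P + a * \<tau>" and rel': "c * P' = d * s' + a * \<tau>'"
    and R_pos: "s + k * \<tau> > 0" and R'_nonneg: "k * \<tau>' - s' \<ge> 0"
begin

abbreviation "S \<equiv> almost_arith a d c k"

text \<open>An \<open>s\<close> by \<open>P'\<close> rectangle without its upper right
  \<open>s'\<close> by \<open>P\<close> block; \<open>det\<close> says that \<open>a\<close> points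
  remain.\<close>

definition "L = {(y, z). 0 \<le> y \<and> y < s \<and> 0 \<le> z \<and> z < P' \<and> (y < s - s' \<or> z < P' - P)}"

lemma L_iff: "(y, z) \<in> L \<longleftrightarrow> 0 \<le> y \<and> y < s \<and> 0 \<le> z \<and> z < P' \<and> (y < s - s' \<or> z < P' - P)"
  by (simp add: L_def)

section \<open>Rounding up to multiples of \<open>k\<close>\<close>

definition "r y = (- y) mod k"

text \<open>The ceiling of \<open>y / k\<close>: for \<open>y \<ge> 0\<close>, the least number of
  progression generators whose indices can sum to \<open>y\<close>.\<close>

definition "ce y = (y + r y) div k"

lemma r_bounds: "0 \<le> r y" "r y < k"
  using k_ge by (auto simp: r_def)

lemma r_eqI: "0 \<le> x \<Longrightarrow> x < k \<Longrightarrow> k dvd y + x \<Longrightarrow> r y = x"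
proof -
  assume x: "0 \<le> x" "x < k" and "k dvd y + x"
  then have "k dvd - y - x" using dvd_minus_iff[of k "y + x"] by simp
  then have "(- y) mod k = x mod k" by (simp add: mod_eq_dvd_iff)
  then show "r y = x" using x by (simp add: r_def)
qed

lemma dvd_r: "k dvd y + r y"
proof -
  have "(- y) mod k = - y - k * ((- y) div k)" by (simp add: minus_div_mult_eq_mod[symmetric] mult.commute)
  then have "y + r y = k * (- ((- y) div k))" by (simp add: r_def)
  then show ?thesis by simp
qed

lemma ce: "k * ce y = y + r y"
  using dvd_r by (simp add: ce_def)

lemma ce_le_iff: "ce y \<le> t \<longleftrightarrow> y \<le> k * t"
proof
  assume "ce y \<le> t"
  then have "k * ce y \<le> k * t" using k_ge by simp
  then show "y \<le> k * t" using ce[of y] r_bounds[of y] by linarith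
next
  assume "y \<le> k * t"
  then have "k * ce y < k * (t + 1)" using ce[of y] r_bounds[of y] by (simp add: algebra_simps)
  then show "ce y \<le> t" using k_ge by simp
qed

lemma ce_mono: "x \<le> y \<Longrightarrow> ce x \<le> ce y"
  using ce_le_iff[of x "ce y"] ce_le_iff[of y "ce y"] by simp

lemma S_iff: "n \<in> S \<longleftrightarrow> (\<exists>t y z. 0 \<le> y \<and> y \<le> k * t \<and> 0 \<le> z \<and> n = a * t + d * y + c * z)"
proof -
  have "0 \<le> t" if "0 \<le> y" "y \<le> k * t" for t y
  proof -
    have "0 \<le> k * t" using that by simp
    then show ?thesis using k_ge by (simp add: zero_le_mult_iff)
  qed
  then show ?thesis using k_ge by (subst almost_arith_iff) auto
qed

section \<open>Reduction of representations into the L-shape\<close>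

text \<open>Outside \<open>L\<close> one of the vectors \<open>(-s, P)\<close>,
  \<open>(s', -P')\<close> or their sum can be added. Shifting \<open>t\<close> by
  \<open>\<tau>\<close>, \<open>\<tau>'\<close> or both keeps the number, and the slack
  \<open>k * t - y\<close> changes by \<open>s + k * \<tau>\<close>, \<open>k * \<tau>' - s'\<close>
  or their sum. The second may be 0, so the induction is lexicographic with \<open>z\<close> as
  tie-breaker.\<close>

lemma reduce:
  "0 \<le> y \<Longrightarrow> 0 \<le> z \<Longrightarrow> y \<le> k * t \<Longrightarrow>
    \<exists>y' z' t'. (y', z') \<in> L \<and> y' \<le> k * t' \<and> a * t + d * y + c * z = a * t' + d * y' + c * z'"
proof (induction "(nat ((a + k * d) * y + k * c * z), nat z)" arbitrary: y z t
    rule: wf_induct_rule[OF wf_lex_prod[OF wf_less_than wf_less_than]])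
  case (1 y z t)
  \<comment> \<open>For the represented number \<open>n\<close>,
    \<open>k * n = W y z + a * (k * t - y)\<close>, so \<open>W\<close> drops by exactly
    \<open>a\<close> times the gain in slack.\<close>
  define W where "W = (\<lambda>y z. (a + k * d) * y + k * c * z)"
  have W_nonneg: "0 \<le> W y z" if "0 \<le> y" "0 \<le> z" for y z
    using that a_pos d_pos c_pos k_ge by (simp add: W_def)
  have IH: "\<exists>y' z' t'. (y', z') \<in> L \<and> y' \<le> k * t' \<and> a * t + d * y + c * z = a * t' + d * y' + c * z'"
    if "0 \<le> y1" "0 \<le> z1" "y1 \<le> k * t1" "W y1 z1 < W y z \<or> W y1 z1 = W y z \<and> z1 < z"
      "a * t + d * y + c * z = a * t1 + d * y1 + c * z1" for y1 z1 t1
  proof -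
    have "((nat (W y1 z1), nat z1), (nat (W y z), nat z)) \<in> less_than <*lex*> less_than"
      using that W_nonneg[of y1 z1] by auto
    then show ?thesis using 1(1)[of y1 z1 t1] that unfolding W_def by simp
  qed
  have W1: "W (y - s) (z + P) = W y z - a * (s + k * \<tau>)"
  proof -
    have "W (y - s) (z + P) = W y z - (a * s + k * (d * s) - k * (c * P))"
      by (simp add: W_def algebra_simps)
    also have "\<dots> = W y z - a * (s + k * \<tau>)" unfolding rel by (simp add: algebra_simps)
    finally show ?thesis .
  qed
  have W2: "W (y + s') (z - P') = W y z - a * (k * \<tau>' - s')"
  proof -
    have "W (y + s') (z - P') = W y z + (a * s' + k * (d * s') - k * (c * P'))"
      by (simp add: W_def algebra_simps)
    also have "\<dots> = W y z - a * (k * \<tau>' - s')" unfolding rel' by (simp add: algebra_simps)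
    finally show ?thesis .
  qed
  have W3: "W (y - s + s') (z + P - P') = W y z - a * (s + k * \<tau>) - a * (k * \<tau>' - s')"
    using W1 W2 by (simp add: W_def algebra_simps)
  have aR: "a * (s + k * \<tau>) > 0" "a * (k * \<tau>' - s') \<ge> 0"
    using a_pos R_pos R'_nonneg by simp_all
  have "y \<ge> s \<or> z \<ge> P' \<or> (y \<ge> s - s' \<and> z \<ge> P' - P) \<or> (y, z) \<in> L"
    using 1(2,3) by (auto simp: L_def)
  then consider "y \<ge> s" | "z \<ge> P'" | "y \<ge> s - s'" "z \<ge> P' - P" | "(y, z) \<in> L" by blast
  then show ?case
  proof cases
    case 1
    have "a * t + d * y + c * z = a * (t + \<tau>) + d * (y - s) + c * (z + P)"
      using rel by (simp add: algebra_simps)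
    moreover have "y - s \<le> k * (t + \<tau>)" using \<open>y \<le> k * t\<close> R_pos by (simp add: distrib_left)
    moreover have "W (y - s) (z + P) < W y z" using W1 aR(1) by linarith
    ultimately show ?thesis
      using 1 \<open>0 \<le> z\<close> P_nonneg by (intro IH[of "y - s" "z + P" "t + \<tau>"]) simp_all
  next
    case 2
    have "a * t + d * y + c * z = a * (t + \<tau>') + d * (y + s') + c * (z - P')"
      using rel' by (simp add: algebra_simps)
    moreover have "y + s' \<le> k * (t + \<tau>')" using \<open>y \<le> k * t\<close> R'_nonneg by (simp add: distrib_left)
    moreover have "W (y + s') (z - P') \<le> W y z" using W2 aR(2) by linarith
    ultimately show ?thesis
      using 2 \<open>0 \<le> y\<close> s'_nonneg P_nonneg P_less
      by (intro IH[of "y + s'" "z - P'" "t + \<tau>'"]) auto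
  next
    case 3
    have "a * t + d * y + c * z = a * (t + \<tau> + \<tau>') + d * (y - s + s') + c * (z + P - P')"
      using rel rel' by (simp add: algebra_simps)
    moreover have "y - s + s' \<le> k * (t + \<tau> + \<tau>')"
      using \<open>y \<le> k * t\<close> R_pos R'_nonneg by (simp add: distrib_left)
    moreover have "W (y - s + s') (z + P - P') < W y z" using W3 aR by linarith
    ultimately show ?thesis
      using 3 by (intro IH[of "y - s + s'" "z + P - P'" "t + \<tau> + \<tau>'"]) simp_all
  next
    case 4
    then show ?thesis using \<open>y \<le> k * t\<close> by blast
  qed
qed

lemma card_L: "finite L" "card L = nat a"
proof -
  have L: "L = {0..<s - s'} \<times> {0..<P'} \<union> {s - s'..<s} \<times> {0..<P' - P}"
    using s'_nonneg s'_less P_nonneg by (auto simp: L_def)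
  show "finite L" by (simp add: L)
  have "card L = nat (s - s') * nat P' + nat s' * nat (P' - P)"
    unfolding L by (subst card_Un_disjoint) (auto simp: card_cartesian_product)
  also have "int \<dots> = (s - s') * P' + s' * (P' - P)"
    using s'_nonneg s'_less P_nonneg P_less by simp
  also have "\<dots> = a" using det by (simp add: algebra_simps)
  finally show "card L = nat a" by simp
qed

lemma rep: obtains y z t where "(y, z) \<in> L" "n = a * t + d * y + c * z"
proof -
  obtain y t where yt: "0 \<le> y" "y < a" "n = a * t + d * y"
    using coprime_solve[OF cop a_pos] .
  \<comment> \<open>Raising \<open>t\<close> makes \<open>reduce\<close> applicable; the excess is
    subtracted from the new \<open>t\<close> afterwards.\<close>
  define t' where "t' = max t (ce y)"
  have "y \<le> k * t'" using ce_le_iff[of y t'] by (simp add: t'_def)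
  then obtain y1 z1 t1 where "(y1, z1) \<in> L" "a * t' + d * y + c * 0 = a * t1 + d * y1 + c * z1"
    using reduce[of y 0 t'] yt(1) by auto
  then have "(y1, z1) \<in> L" "n = a * (t1 + t - t') + d * y1 + c * z1"
    using yt(3) by (simp_all add: algebra_simps)
  then show ?thesis by (rule that)
qed

text \<open>By \<open>rep\<close> the map is onto the \<open>a\<close> residues, and
  \<open>L\<close> has exactly \<open>a\<close> points.\<close>

lemma inj_residue: "inj_on (\<lambda>(y, z). (d * y + c * z) mod a) L"
proof -
  have "(\<lambda>(y, z). (d * y + c * z) mod a) ` L = {0..<a}"
  proof (intro equalityI subsetI)
    fix n assume "n \<in> {0..<a}"
    obtain y z t where "(y, z) \<in> L" "n = a * t + d * y + c * z" by (rule rep)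
    moreover from this have "n mod a = (d * y + c * z) mod a" by (simp add: add.assoc)
    then have "n = (d * y + c * z) mod a" using \<open>n \<in> {0..<a}\<close> by simp
    ultimately show "n \<in> (\<lambda>(y, z). (d * y + c * z) mod a) ` L" by force
  qed (use a_pos in auto)
  then show ?thesis using card_L by (intro eq_card_imp_inj_on) simp_all
qed

lemma rep_unique:
  assumes "(y, z) \<in> L" "(y', z') \<in> L" "a * t + d * y + c * z = a * t' + d * y' + c * z'"
  shows "y = y'" "z = z'" "t = t'"
proof -
  have "d * y + c * z = d * y' + c * z' + a * (t' - t)" using assms(3) by (simp add: algebra_simps)
  then have "(d * y + c * z) mod a = (d * y' + c * z') mod a" by simp
  then have "(y, z) = (y', z')" using inj_onD[OF inj_residue, of "(y, z)" "(y', z')"] assms by simp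
  then show "y = y'" "z = z'" "t = t'" using assms(3) a_pos by auto
qed

text \<open>Reducing a representation with \<open>y1 \<le> k * t1\<close> ends at the unique one
  through \<open>L\<close>, which inherits the inequality. So the Apery element of this class is
  \<open>a * ce y + d * y + c * z\<close>.\<close>

lemma S_rep_iff:
  assumes "(y, z) \<in> L"
  shows "a * t + d * y + c * z \<in> S \<longleftrightarrow> ce y \<le> t"
proof
  assume "a * t + d * y + c * z \<in> S"
  then obtain t1 y1 z1 where 1: "0 \<le> y1" "y1 \<le> k * t1" "0 \<le> z1"
    "a * t + d * y + c * z = a * t1 + d * y1 + c * z1"
    using S_iff by blast
  obtain y2 z2 t2 where 2: "(y2, z2) \<in> L" "y2 \<le> k * t2"
    "a * t + d * y + c * z = a * t2 + d * y2 + c * z2"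
    using reduce[OF 1(1,3,2)] 1(4) by metis
  then show "ce y \<le> t" using rep_unique[OF assms 2(1,3)] ce_le_iff by simp
next
  assume "ce y \<le> t"
  moreover have "0 \<le> y" "0 \<le> z" using assms by (auto simp: L_def)
  ultimately show "a * t + d * y + c * z \<in> S" using S_iff ce_le_iff by blast
qed

lemma frobenius_S: "frobenius S \<notin> S" "n > frobenius S \<Longrightarrow> n \<in> S"
proof -
  have *: "\<exists>b. \<forall>n\<ge>b. n \<in> S"
    using a_pos d_pos c_pos k_ge cop by (intro coprime_almost_arith_cofinite) simp_all
  have **: "\<forall>n\<in>S. n \<ge> 0"
    using almost_arith_nonneg[of a d c k] a_pos d_pos c_pos k_ge by auto
  show "frobenius S \<notin> S" "n > frobenius S \<Longrightarrow> n \<in> S"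
    using frobenius_props[OF * **] by auto
qed

subsection \<open>Reflection in a corner\<close>

text \<open>With \<open>(Y, Z)\<close> the exponents of the largest Apery element, \<open>frob Y Z\<close> is the Frobenius number and
  \<open>reflects Y Z y z y' z' \<rho>\<close> says that \<open>(y', z')\<close> represents the residue class of its reflection.
  The number of integers \<open>n\<close> in the residue class of \<open>d * y + c * z\<close> with \<open>n\<close> and \<open>frob Y Z - n\<close> both
  outside the semigroup is \<open>defect Y y y' \<rho> div k\<close>.\<close>
definition "frob Y Z = a * (ce Y - 1) + d * Y + c * Z"

definition "reflects Y Z y z y' z' \<rho> \<longleftrightarrow>
  (\<exists>\<sigma>. d * (Y - y) + c * (Z - z) = a * \<sigma> + d * y' + c * z' \<and> \<rho> = y + y' - Y - k * \<sigma>)"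

definition "defect Y y y' \<rho> = r y + r y' - r Y + \<rho>"

lemma reflects_box: "reflects Y Z y z (Y - y) (Z - z) 0"
  unfolding reflects_def by (intro exI[of _ 0]) simp

text \<open>The point \<open>(Y - y, Z - z)\<close> may leave \<open>L\<close>. The vector
  \<open>(s, -P)\<close> serves to bring it back beside the box below the corner, and
  \<open>(-s', P')\<close> in \<open>reflects_upper\<close> to bring it back above the box; the last
  argument is the $R_v$ or $-R_{v+1}$ attached to the vector.\<close>

lemma reflects_right: "reflects Y Z y z (s + Y - y) (Z - P - z) (s + k * \<tau>)"
  unfolding reflects_def using rel by (intro exI[of _ "- \<tau>"]) (simp add: algebra_simps)

lemma reflects_upper: "reflects Y Z y z (Y - s' - y) (Z + P' - z) (k * \<tau>' - s')"
  unfolding reflects_def using rel' by (intro exI[of _ "- \<tau>'"]) (simp add: algebra_simps)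

text \<open>The first condition bounds \<open>t\<close> above through \<open>(y, z)\<close>, the
  second below through \<open>(y', z')\<close>. The unmatched numbers of a class thus form an
  interval, of length \<open>ce y + ce y' - ce Y - \<sigma>\<close> if this is positive.\<close>

lemma unmatched_iff:
  assumes "(y, z) \<in> L" "(y', z') \<in> L"
    and "d * (Y - y) + c * (Z - z) = a * \<sigma> + d * y' + c * z'"
  shows "a * t + d * y + c * z \<notin> S \<and> frob Y Z - (a * t + d * y + c * z) \<notin> S \<longleftrightarrow>
    ce Y + \<sigma> - ce y' \<le> t \<and> t < ce y"
proof -
  have "frob Y Z - (a * t + d * y + c * z) = a * (ce Y - 1 - t + \<sigma>) + d * y' + c * z'"
    using assms(3) by (simp add: frob_def algebra_simps)
  then show ?thesis using S_rep_iff[OF assms(1), of t] S_rep_iff[OF assms(2), of "ce Y - 1 - t + \<sigma>"]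
    by auto
qed

lemma defect_eq: "\<rho> = y + y' - Y - k * \<sigma> \<Longrightarrow> defect Y y y' \<rho> = k * (ce y + ce y' - ce Y - \<sigma>)"
  using ce[of y] ce[of y'] ce[of Y] by (simp add: defect_def algebra_simps)

lemma frob_notin: "(Y, Z) \<in> L \<Longrightarrow> frob Y Z \<notin> S"
  using S_rep_iff[of Y Z "ce Y - 1"] by (simp add: frob_def)

text \<open>A negative value would give elements of \<open>S\<close> in the two classes that add up
  to the gap \<open>frob Y Z\<close>.\<close>

lemma defect_nonneg:
  assumes "(Y, Z) \<in> L" "(y, z) \<in> L" "(y', z') \<in> L" "reflects Y Z y z y' z' \<rho>"
  shows "defect Y y y' \<rho> \<ge> 0"
proof (rule ccontr)
  assume neg: "\<not> ?thesis"
  obtain \<sigma> where \<sigma>: "d * (Y - y) + c * (Z - z) = a * \<sigma> + d * y' + c * z'" "\<rho> = y + y' - Y - k * \<sigma>"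
    using assms(4) reflects_def by auto
  have "k * (ce y + ce y' - ce Y - \<sigma>) < 0" using neg defect_eq[OF \<sigma>(2)] by simp
  then have less: "ce y + ce y' - ce Y - \<sigma> < 0" using k_ge by (simp add: mult_less_0_iff)
  have "a * ce y + d * y + c * z \<in> S" using S_rep_iff[OF assms(2)] by simp
  moreover have "a * (ce Y - 1 - ce y + \<sigma>) + d * y' + c * z' \<in> S"
    using less by (subst S_rep_iff[OF assms(3)]) simp
  ultimately have "(a * ce y + d * y + c * z) + (a * (ce Y - 1 - ce y + \<sigma>) + d * y' + c * z') \<in> S"
    by (rule semigroup_gen_add)
  moreover have "(a * ce y + d * y + c * z) + (a * (ce Y - 1 - ce y + \<sigma>) + d * y' + c * z') = frob Y Z"
    using \<sigma>(1) by (simp add: frob_def algebra_simps)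
  ultimately show False using frob_notin[OF assms(1)] by simp
qed

section \<open>Pseudo-symmetry in terms of defects\<close>

text \<open>Both ends of the nonempty interval of unmatched numbers must be half of
  \<open>frob Y Z\<close>, so its length is one. As that half is its own reflection, uniqueness in
  \<open>L\<close> identifies \<open>(y', z')\<close> with \<open>(y, z)\<close>.\<close>

lemma pseudo_symmetric_defect_pos:
  assumes "pseudo_symmetric S" "frobenius S = frob Y Z"
    and L: "(y, z) \<in> L" "(y', z') \<in> L" and rf: "reflects Y Z y z y' z' \<rho>"
    and pos: "defect Y y y' \<rho> > 0"
  shows "frob Y Z div 2 = a * (ce y - 1) + d * y + c * z"
    and "y' = y" "z' = z" "defect Y y y' \<rho> = k"
proof -
  have U: "even (frob Y Z)" "\<And>n. n \<notin> S \<and> frob Y Z - n \<notin> S \<longleftrightarrow> n = frob Y Z div 2"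
    using assms(1) pseudo_symmetric_unmatched[OF assms(2)] by auto
  obtain \<sigma> where \<sigma>: "d * (Y - y) + c * (Z - z) = a * \<sigma> + d * y' + c * z'" "\<rho> = y + y' - Y - k * \<sigma>"
    using rf reflects_def by auto
  note D = defect_eq[OF \<sigma>(2)]
  have gt: "ce y + ce y' - ce Y - \<sigma> > 0" using pos D k_ge by (simp add: zero_less_mult_iff)
  note un = unmatched_iff[OF L \<sigma>(1)]
  show 1: "frob Y Z div 2 = a * (ce y - 1) + d * y + c * z"
    using un[of "ce y - 1"] U(2)[of "a * (ce y - 1) + d * y + c * z"] gt by auto
  have "frob Y Z div 2 = a * (ce Y + \<sigma> - ce y') + d * y + c * z"
    using un[of "ce Y + \<sigma> - ce y'"] U(2)[of "a * (ce Y + \<sigma> - ce y') + d * y + c * z"] gt by auto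
  then have "ce y - 1 = ce Y + \<sigma> - ce y'" using 1 rep_unique(3)[OF L(1) L(1)] by metis
  then have "ce y + ce y' - ce Y - \<sigma> = 1" by simp
  then show "defect Y y y' \<rho> = k" using D by simp
  have "frob Y Z = 2 * (frob Y Z div 2)" using U(1) by simp
  then have "a * (ce y - 1) + d * y + c * z = frob Y Z - (a * (ce y - 1) + d * y + c * z)"
    using 1 by linarith
  also have "\<dots> = a * (ce Y - ce y + \<sigma>) + d * y' + c * z'"
    using \<sigma>(1) by (simp add: frob_def algebra_simps)
  finally show "y' = y" "z' = z" using rep_unique[OF L] by metis+
qed

lemma pseudo_symmetric_defect_unique:
  assumes "pseudo_symmetric S" "frobenius S = frob Y Z"
    and "(y, z) \<in> L" "(y', z') \<in> L" "reflects Y Z y z y' z' \<rho>" "defect Y y y' \<rho> > 0"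
    and "(w, x) \<in> L" "(w', x') \<in> L" "reflects Y Z w x w' x' \<pi>" "defect Y w w' \<pi> > 0"
  shows "y = w" "z = x"
proof -
  have "a * (ce y - 1) + d * y + c * z = a * (ce w - 1) + d * w + c * x"
    using pseudo_symmetric_defect_pos(1)[OF assms(1-6)]
      pseudo_symmetric_defect_pos(1)[OF assms(1,2,7-10)] by simp
  then show "y = w" "z = x" using rep_unique[OF assms(3,7)] by blast+
qed

text \<open>The point is the one in the class of half the Frobenius number. Which vector returns its
  reflection to \<open>L\<close> depends on its position, so the claim covers every admissible
  \<open>(y', z')\<close>.\<close>

lemma pseudo_symmetric_defect_exists:
  assumes "pseudo_symmetric S" "frobenius S = frob Y Z"
  obtains y z where "(y, z) \<in> L"
    and "\<And>y' z' \<rho>. (y', z') \<in> L \<Longrightarrow> reflects Y Z y z y' z' \<rho> \<Longrightarrow> defect Y y y' \<rho> > 0"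
proof -
  have U: "n \<notin> S \<and> frob Y Z - n \<notin> S \<longleftrightarrow> n = frob Y Z div 2" for n
    using assms(1) pseudo_symmetric_unmatched[OF assms(2)] by auto
  obtain y z t where yz: "(y, z) \<in> L" "frob Y Z div 2 = a * t + d * y + c * z" by (rule rep)
  show ?thesis
  proof (rule that[OF yz(1)])
    fix y' z' \<rho>
    assume L': "(y', z') \<in> L" and "reflects Y Z y z y' z' \<rho>"
    then obtain \<sigma> where \<sigma>: "d * (Y - y) + c * (Z - z) = a * \<sigma> + d * y' + c * z'"
      "\<rho> = y + y' - Y - k * \<sigma>" using reflects_def by auto
    have "ce Y + \<sigma> - ce y' \<le> t \<and> t < ce y"
      using unmatched_iff[OF yz(1) L' \<sigma>(1), of t] U[of "a * t + d * y + c * z"] yz(2) by simp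
    then show "defect Y y y' \<rho> > 0" using defect_eq[OF \<sigma>(2)] k_ge by (simp add: zero_less_mult_iff)
  qed
qed

text \<open>That \<open>frob Y Z\<close> is the Frobenius number is a conclusion: a gap beyond it
  would be unmatched, since its reflection is negative, yet the only unmatched number is half of
  \<open>frob Y Z\<close>, which is nonnegative.\<close>

lemma pseudo_symmetricI:
  assumes tp: "(Y, Z) \<in> L" "Y \<ge> 1"
    and L0: "(y\<^sub>0, z\<^sub>0) \<in> L" and rf0: "reflects Y Z y\<^sub>0 z\<^sub>0 y\<^sub>0 z\<^sub>0 \<rho>\<^sub>0" and k0: "defect Y y\<^sub>0 y\<^sub>0 \<rho>\<^sub>0 = k"
    and others: "\<And>y z. (y, z) \<in> L \<Longrightarrow> (y, z) \<noteq> (y\<^sub>0, z\<^sub>0) \<Longrightarrow>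
      \<exists>y' z' \<rho>. (y', z') \<in> L \<and> reflects Y Z y z y' z' \<rho> \<and> defect Y y y' \<rho> \<le> 0"
  shows "pseudo_symmetric S"
proof -
  define g where "g = frob Y Z"
  define n0 where "n0 = a * (ce y\<^sub>0 - 1) + d * y\<^sub>0 + c * z\<^sub>0"
  obtain \<sigma> where \<sigma>: "d * (Y - y\<^sub>0) + c * (Z - z\<^sub>0) = a * \<sigma> + d * y\<^sub>0 + c * z\<^sub>0"
    "\<rho>\<^sub>0 = y\<^sub>0 + y\<^sub>0 - Y - k * \<sigma>" using rf0 reflects_def by auto
  have one: "ce y\<^sub>0 + ce y\<^sub>0 - ce Y - \<sigma> = 1" using defect_eq[OF \<sigma>(2)] k0 k_ge by simp
  have U: "n \<notin> S \<and> g - n \<notin> S \<longleftrightarrow> n = n0" for n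
  proof
    assume n: "n \<notin> S \<and> g - n \<notin> S"
    obtain y z t where yz: "(y, z) \<in> L" "n = a * t + d * y + c * z" by (rule rep)
    have "(y, z) = (y\<^sub>0, z\<^sub>0)"
    proof (rule ccontr)
      assume "(y, z) \<noteq> (y\<^sub>0, z\<^sub>0)"
      then obtain y' z' \<rho> where o: "(y', z') \<in> L" "reflects Y Z y z y' z' \<rho>" "defect Y y y' \<rho> \<le> 0"
        using others yz(1) by metis
      then obtain \<sigma>' where \<sigma>': "d * (Y - y) + c * (Z - z) = a * \<sigma>' + d * y' + c * z'"
        "\<rho> = y + y' - Y - k * \<sigma>'" using reflects_def by auto
      have "ce y + ce y' - ce Y - \<sigma>' \<le> 0"
        using o(3) defect_eq[OF \<sigma>'(2)] k_ge by (simp add: mult_le_0_iff)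
      then show False using unmatched_iff[OF yz(1) o(1) \<sigma>'(1), of t] n yz(2) g_def by simp
    qed
    then have "ce Y + \<sigma> - ce y\<^sub>0 \<le> t \<and> t < ce y\<^sub>0"
      using unmatched_iff[OF L0 L0 \<sigma>(1), of t] n yz(2) g_def by simp
    then have "t = ce y\<^sub>0 - 1" using one by simp
    then show "n = n0" using yz(2) \<open>(y, z) = (y\<^sub>0, z\<^sub>0)\<close> by (simp add: n0_def)
  next
    assume "n = n0"
    then show "n \<notin> S \<and> g - n \<notin> S"
      using unmatched_iff[OF L0 L0 \<sigma>(1), of "ce y\<^sub>0 - 1"] one by (simp add: g_def n0_def)
  qed
  \<comment> \<open>Reflection permutes the unmatched numbers, so it fixes the only one.\<close>
  from U[of n0] U[of "g - n0"] have g: "g = 2 * n0" by simp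
  have "0 < ce Y" using tp(2) ce_le_iff[of Y 0] by simp
  then have "0 \<le> g" using tp a_pos d_pos c_pos unfolding g_def frob_def L_def by simp
  have "frobenius S = g"
  proof (rule frobenius_eqI)
    show "g \<notin> S" using frob_notin[OF tp(1)] by (simp add: g_def)
    fix n assume n: "n > g"
    show "n \<in> S"
    proof (rule ccontr)
      assume "n \<notin> S"
      moreover have "g - n \<notin> S"
        using almost_arith_nonneg[of a d c k "g - n"] n a_pos d_pos c_pos k_ge by auto
      ultimately have "n = n0" using U by blast
      then show False using n g \<open>0 \<le> g\<close> by simp
    qed
  qed
  then show ?thesis using pseudo_symmetric_unmatched U g by simp
qed

text \<open>A gap at \<open>(y, z)\<close> has \<open>t \<le> ce y - 1\<close>, so moving to larger
  exponents bounds it by \<open>frob Y Z\<close>, itself a gap.\<close>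

lemma frobenius_eq_frobI:
  assumes "frobenius S = a * t + d * y + c * z" "(y, z) \<in> L" "(Y, Z) \<in> L" "y \<le> Y" "z \<le> Z"
  shows "frobenius S = frob Y Z"
proof -
  have "t < ce y" using S_rep_iff[OF assms(2), of t] frobenius_S(1) assms(1) by auto
  then have "t \<le> ce Y - 1" using ce_mono[OF assms(4)] by simp
  then have "a * t \<le> a * (ce Y - 1)" "d * y \<le> d * Y" "c * z \<le> c * Z"
    using assms a_pos d_pos c_pos by simp_all
  then have "frobenius S \<le> frob Y Z" using assms(1) by (simp add: frob_def)
  moreover have "\<not> frobenius S < frob Y Z" using frobenius_S(2) frob_notin[OF assms(3)] by blast
  ultimately show ?thesis by simp
qed

lemma frobenius_corner:
  "frobenius S = frob (s - s' - 1) (P' - 1) \<or> frobenius S = frob (s - 1) (P' - P - 1)"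
proof -
  obtain y z t where yz: "(y, z) \<in> L" "frobenius S = a * t + d * y + c * z" by (rule rep)
  have L: "(s - s' - 1, P' - 1) \<in> L" "(s - 1, P' - P - 1) \<in> L"
    using s'_nonneg s'_less P_nonneg P_less by (auto simp: L_def)
  show ?thesis
  proof (cases "y < s - s'")
    case True
    then show ?thesis using frobenius_eq_frobI[OF yz(2,1) L(1)] yz(1) by (simp add: L_def)
  next
    case False
    then show ?thesis using frobenius_eq_frobI[OF yz(2,1) L(2)] yz(1) by (simp add: L_def)
  qed
qed

section \<open>Rounding residues and the box below the corner\<close>

lemma r_cong: "k dvd x - y \<Longrightarrow> r x = r y"
  using r_eqI[of "r y" x] r_bounds[of y] dvd_add[OF _ dvd_r[of y], of "x - y"] by simp

lemma r_0: "r 0 = 0" and r_1: "r 1 = k - 1" and r_2: "r 2 = k - 2"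
  using k_ge by (auto intro!: r_eqI)

lemma r_eq_pred_iff: "r y = k - 1 \<longleftrightarrow> k dvd y - 1"
proof
  assume "r y = k - 1"
  then have "y - 1 = (y + r y) - k" by simp
  then show "k dvd y - 1" by (metis dvd_diff dvd_r dvd_refl)
next
  assume "k dvd y - 1"
  then show "r y = k - 1" using r_cong[of y 1] r_1 by simp
qed

lemma dvd_eqI:
  assumes "k dvd x" "0 < x" "x < 2 * k" shows "x = k"
proof -
  obtain m where m: "x = k * m" using assms(1) by blast
  then have "0 < m" using assms(2) k_ge by (simp add: zero_less_mult_iff)
  moreover have "k * m < k * 2" using assms(3) m by simp
  then have "m < 2" using k_ge by simp
  ultimately have "m = 1" by simp
  then show ?thesis using m by simp
qed

text \<open>\<open>r y + r y' + 1\<close> is a positive multiple of \<open>k\<close> below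
  \<open>2 * k\<close>.\<close>

lemma r_add_pred:
  assumes "k dvd y + y' - 1" shows "r y + r y' = k - 1"
proof -
  have "k dvd (y + r y) + (y' + r y') - (y + y' - 1)"
    by (rule dvd_diff[OF dvd_add[OF dvd_r dvd_r] assms])
  then have "k dvd r y + r y' + 1" by (simp add: add.assoc)
  then have "r y + r y' + 1 = k"
    using r_bounds[of y] r_bounds[of y'] by (intro dvd_eqI) auto
  then show ?thesis by simp
qed

lemma box_defect:
  assumes "k dvd Y - 1" shows "defect Y y (Y - y) 0 = 0"
  using assms r_add_pred[of y "Y - y"] r_eq_pred_iff[of Y] by (simp add: defect_def)

text \<open>\<open>r 1 = k - 1\<close> is the largest rounding amount, and \<open>r Y\<close> is
  smaller.\<close>

lemma box_defect_one:
  assumes "\<not> k dvd Y - 1" shows "defect Y 1 (Y - 1) 0 > 0"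
  using assms r_eq_pred_iff[of Y] r_bounds[of Y] r_bounds[of "Y - 1"] r_1 by (simp add: defect_def)

text \<open>Defects in the box do not depend on \<open>z\<close>, so uniqueness leaves a single row.
  If any box point fails, so does \<open>y = 1\<close>; hence that is the failing point, and being
  its own reflection it gives \<open>Y = 2\<close>.\<close>

lemma box_exceptional:
  assumes ps: "pseudo_symmetric S" "frobenius S = frob Y Z"
    and box: "\<And>y z. 0 \<le> y \<Longrightarrow> y \<le> Y \<Longrightarrow> 0 \<le> z \<Longrightarrow> z \<le> Z \<Longrightarrow> (y, z) \<in> L"
    and yz: "0 \<le> y" "y \<le> Y" "0 \<le> z" "z \<le> Z" and pos: "defect Y y (Y - y) 0 > 0"
  shows "Y = 2" "Z = 0"
proof -
  have "Y - y = y" "Z - z = z"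
    using pseudo_symmetric_defect_pos(2,3)[OF ps box box reflects_box pos] yz by auto
  have "z = 0"
    using pseudo_symmetric_defect_unique(2)[OF ps box box reflects_box pos box box reflects_box pos, of z 0] yz
    by auto
  then show "Z = 0" using \<open>Z - z = z\<close> by simp
  have "y \<noteq> 0" using pos by (auto simp: defect_def r_0)
  moreover have "\<not> k dvd Y - 1" using box_defect pos by fastforce
  then have pos1: "defect Y 1 (Y - 1) 0 > 0" by (rule box_defect_one)
  ultimately have "y = 1"
    using pseudo_symmetric_defect_unique(1)[OF ps box box reflects_box pos box box reflects_box pos1, of z z] yz
      \<open>Y - y = y\<close> by auto
  then show "Y = 2" using \<open>Y - y = y\<close> by simp
qed

section \<open>Necessary conditions at each corner\<close>

text \<open>The shape is a full rectangle, so the failing point lies in the box.\<close>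

lemma pseudo_symmetric_rectangle:
  assumes ps: "pseudo_symmetric S" and rect: "P = 0 \<or> s' = 0"
  shows "s = 3" "P = 0" "P' = 1"
proof -
  have L: "(y, z) \<in> L \<longleftrightarrow> 0 \<le> y \<and> y \<le> s - 1 \<and> 0 \<le> z \<and> z \<le> P' - 1" for y z
    using rect by (auto simp: L_def)
  obtain y z t where "(y, z) \<in> L" "frobenius S = a * t + d * y + c * z" by (rule rep)
  then have fr: "frobenius S = frob (s - 1) (P' - 1)"
    using s'_nonneg s'_less P_nonneg P_less
    by (intro frobenius_eq_frobI[of t y z]) (auto simp: L)
  obtain y z where yz: "(y, z) \<in> L"
    and ex: "\<And>y' z' \<rho>. (y', z') \<in> L \<Longrightarrow> reflects (s - 1) (P' - 1) y z y' z' \<rho> \<Longrightarrow> defect (s - 1) y y' \<rho> > 0"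
    using pseudo_symmetric_defect_exists[OF ps fr] by blast
  have "defect (s - 1) y (s - 1 - y) 0 > 0"
    using yz by (intro ex[OF _ reflects_box]) (auto simp: L)
  then have "s - 1 = 2" "P' - 1 = 0"
    using box_exceptional[OF ps fr, of y z] yz by (auto simp: L)
  then show "s = 3" "P = 0" "P' = 1" using P_nonneg P_less by auto
qed

text \<open>The box has several rows as \<open>P > 0\<close>, so the failing point lies to its
  right. There the defect depends on \<open>y\<close> alone, which forces one row; what remains is
  to find its only failing point, the midpoint \<open>y0\<close>.\<close>

lemma pseudo_symmetric_left_corner:
  assumes ps: "pseudo_symmetric S" and proper: "P > 0" "s' > 0"
    and fr: "frobenius S = frob (s - s' - 1) (P' - 1)"
  shows "P' = P + 1" "(s' = 1 \<and> s + k * \<tau> = 3) \<or> (s' = 2 * k - 1 \<and> s + k * \<tau> = 1)"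
proof -
  define Y Z R where "Y = s - s' - 1" and "Z = P' - 1" and "R = s + k * \<tau>"
  note fr = fr[folded Y_def Z_def]
  have R: "R > 0" using R_pos by (simp add: R_def)
  have Y: "Y \<ge> 0" using s'_less by (simp add: Y_def)
  have LYZ: "(Y, Z) \<in> L" using s'_less proper P_less by (auto simp: L_def Y_def Z_def)
  have box: "(y, z) \<in> L" if "0 \<le> y" "y \<le> Y" "0 \<le> z" "z \<le> Z" for y z
    using that proper by (auto simp: L_def Y_def Z_def)
  have right: "(y, z) \<in> L" if "Y < y" "y < s" "0 \<le> z" "z < P' - P" for y z
    using that Y proper P_less by (auto simp: L_def)
  have rf: "reflects Y Z y z (s + Y - y) (P' - P - 1 - z) R" for y z
    using reflects_right[of Y Z y z] by (simp add: R_def Z_def algebra_simps)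
  have nobox: "\<not> defect Y y (Y - y) 0 > 0" if "0 \<le> y" "y \<le> Y" for y
    using box_exceptional(2)[OF ps fr box, of y 0] that proper P_less by (auto simp: Z_def)
  obtain y0 z0 where L0: "(y0, z0) \<in> L"
    and ex: "\<And>y' z' \<rho>. (y', z') \<in> L \<Longrightarrow> reflects Y Z y0 z0 y' z' \<rho> \<Longrightarrow> defect Y y0 y' \<rho> > 0"
    using pseudo_symmetric_defect_exists[OF ps fr] by blast
  have y0: "Y < y0"
  proof (rule ccontr)
    assume "\<not> Y < y0"
    moreover from this have "defect Y y0 (Y - y0) 0 > 0"
      using L0 by (intro ex[OF _ reflects_box] box) (auto simp: L_def Z_def)
    ultimately show False using nobox[of y0] L0 by (simp add: L_def)
  qed
  have z0: "0 \<le> z0" "z0 < P' - P" "y0 < s" using L0 y0 by (auto simp: L_def Y_def)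
  define D where "D = (\<lambda>y. defect Y y (s + Y - y) R)"
  have Dpos: "D y0 > 0"
    unfolding D_def using y0 z0 by (intro ex[OF _ rf] right) auto
  have D_unique: "y = y0 \<and> z = z0" if "D y > 0" "Y < y" "y < s" "0 \<le> z" "z < P' - P" for y z
    using pseudo_symmetric_defect_unique[OF ps fr right right rf _ right right rf, of y z y0 z0]
      that y0 z0 Dpos by (auto simp: D_def)
  have selfdual: "2 * y0 = s + Y" and "z0 = P' - P - 1 - z0" and Dk: "D y0 = k"
    using pseudo_symmetric_defect_pos[OF ps fr right right rf, of y0 z0] y0 z0 Dpos by (auto simp: D_def)
  moreover have "z0 = 0" using D_unique[of y0 0] Dpos y0 z0 P_less by simp
  ultimately show "P' = P + 1" by simp
  have Dz: "D y = 0" if "Y < y" "y < s" "y \<noteq> y0" for y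
    using defect_nonneg[OF LYZ right right rf, of y 0] D_unique[of y 0] that P_less
    by (fastforce simp: D_def)
  have D_eq: "D y = r y + r (s + Y - y) - r Y + R" for y by (simp add: D_def defect_def)
  show "(s' = 1 \<and> s + k * \<tau> = 3) \<or> (s' = 2 * k - 1 \<and> s + k * \<tau> = 1)"
  proof (cases "Y = 0")
    case True
    \<comment> \<open>The whole strip fails, so \<open>y0 = 1\<close>, and the value
      \<open>k\<close> there would need \<open>R = 2 - k\<close>, which is not positive.\<close>
    have "D y > 0" for y using True R r_0 r_bounds[of y] r_bounds[of "s - y"] by (simp add: D_eq)
    from this[of 1] have "y0 = 1" using Dz[of 1] True proper unfolding Y_def by fastforce
    then have "2 * (k - 1) + R = k" using Dk selfdual True r_0 r_1 by (simp add: D_eq)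
    then show ?thesis using R k_ge by simp
  next
    case False
    then have dY: "k dvd Y - 1" using nobox[of 1] box_defect_one[of Y] Y by fastforce
    then have rY: "r Y = k - 1" using r_eq_pred_iff by simp
    have rY1: "r (Y + 1) = k - 2" using r_cong[of "Y + 1" 2] dY r_2 by simp
    show ?thesis
    proof (cases "s' = 1")
      case True
      then have "y0 = Y + 1" "s + Y - y0 = Y + 1" using y0 z0 by (simp_all add: Y_def)
      then have "r y0 = k - 2" "r (s + Y - y0) = k - 2" by (simp_all only: rY1)
      then have "R = 3" using Dk D_eq[of y0] rY by linarith
      then show ?thesis using True by (simp add: R_def)
    next
      case False
      \<comment> \<open>\<open>y0 = Y + 1\<close> would give \<open>s' = 1\<close>. The vanishing of
        this defect fixes \<open>R\<close> and the residue of \<open>s\<close>.\<close>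
      then have "D (Y + 1) = 0" using proper selfdual by (intro Dz) (auto simp: Y_def)
      then have "r (s - 1) + R = 1" using rY rY1 by (simp add: D_eq)
      then have R1: "R = 1" and rs: "r (s - 1) = 0" using R r_bounds[of "s - 1"] by auto
      then have ds: "k dvd s - 1" using dvd_r[of "s - 1"] by simp
      have "y0 \<ge> Y + k"
      proof (rule ccontr)
        assume less: "\<not> y0 \<ge> Y + k"
        \<comment> \<open>For \<open>i \<le> k - 2\<close> the two rounding amounts are
          \<open>k - 2 - i\<close> and \<open>i\<close>; their sum cancels
          \<open>r Y - R\<close>.\<close>
        define i where "i = y0 - Y - 1"
        have i: "0 \<le> i" "i \<le> k - 2" using y0 less by (auto simp: i_def)
        have "y0 + (k - 2 - i) = (Y - 1) + k" by (simp add: i_def)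
        then have "k dvd y0 + (k - 2 - i)" using dvd_add[OF dY dvd_refl] by (simp only:)
        then have "r y0 = k - 2 - i" using i by (intro r_eqI) auto
        moreover have "(s + Y - y0) + i = s - 1" by (simp add: i_def)
        then have "k dvd (s + Y - y0) + i" using ds by (simp only:)
        then have "r (s + Y - y0) = i" using i by (intro r_eqI) auto
        ultimately have "D y0 = 0" using rY R1 by (simp add: D_eq)
        then show False using Dpos by simp
      qed
      have "r (Y + k) = k - 1" using dY r_cong[of "Y + k" Y] rY by simp
      moreover have "r (s - k) = k - 1"
      proof -
        have "k dvd (s - k) - 1" using dvd_diff[OF ds dvd_refl] by (simp add: algebra_simps)
        then show ?thesis using r_eq_pred_iff by simp
      qed
      \<comment> \<open>Both rounding amounts are \<open>k - 1\<close> here, so this is the failing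
        point, and the midpoint equation yields \<open>s'\<close>.\<close>
      ultimately have "D (Y + k) > 0" using rY R1 k_ge by (simp add: D_eq)
      then have "Y + k = y0"
        using D_unique[of "Y + k" 0] \<open>y0 \<ge> Y + k\<close> z0 k_ge P_less by simp
      then have "s' = 2 * k - 1" using selfdual by (simp add: Y_def)
      then show ?thesis using R1 by (simp add: R_def)
    qed
  qed
qed

text \<open>Either the failing point lies in the box, which is then a row of three points, or it
  lies in the \<open>P\<close> rows above. In the second case independence of \<open>z\<close>
  leaves one row of \<open>n\<close> points, whose midpoint fails.\<close>

lemma pseudo_symmetric_right_corner:
  assumes ps: "pseudo_symmetric S" and proper: "P > 0" "s' > 0"
    and fr: "frobenius S = frob (s - 1) (P' - P - 1)"
  shows "(s = 3 \<and> s' = 2 \<and> P' = P + 1 \<and> k * \<tau>' - s' = k - 2) \<or>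
    (P = 1 \<and> s = s' + 1 \<and> k * \<tau>' - s' = 2 * k - 1) \<or> (P = 1 \<and> s = s' + 3 \<and> k * \<tau>' - s' = 1)"
proof -
  define Y Z R n where "Y = s - 1" and "Z = P' - P - 1" and "R = k * \<tau>' - s'" and "n = s - s'"
  note fr = fr[folded Y_def Z_def]
  have R: "R \<ge> 0" using R'_nonneg by (simp add: R_def)
  have Y: "Y \<ge> 1" using s'_less proper by (simp add: Y_def)
  have n: "n \<ge> 1" using s'_less by (simp add: n_def)
  have LYZ: "(Y, Z) \<in> L" using s'_less proper P_less by (auto simp: L_def Y_def Z_def)
  have box: "(y, z) \<in> L" if "0 \<le> y" "y \<le> Y" "0 \<le> z" "z \<le> Z" for y z
    using that proper by (auto simp: L_def Y_def Z_def)
  have upper: "(y, z) \<in> L" if "0 \<le> y" "y < n" "Z < z" "z < P'" for y z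
    using that proper P_less by (auto simp: L_def Z_def n_def)
  have rf: "reflects Y Z y z (n - 1 - y) (2 * P' - P - 1 - z) R" for y z
    using reflects_upper[of Y Z y z] by (simp add: R_def Z_def Y_def n_def algebra_simps)
  obtain y0 z0 where L0: "(y0, z0) \<in> L"
    and ex: "\<And>y' z' \<rho>. (y', z') \<in> L \<Longrightarrow> reflects Y Z y0 z0 y' z' \<rho> \<Longrightarrow> defect Y y0 y' \<rho> > 0"
    using pseudo_symmetric_defect_exists[OF ps fr] by blast
  have y0: "0 \<le> y0" "y0 \<le> Y" "0 \<le> z0" using L0 by (auto simp: L_def Y_def)
  define D where "D = (\<lambda>y. defect Y y (n - 1 - y) R)"
  have D_eq: "D y = r y + r (n - 1 - y) - r Y + R" for y by (simp add: D_def defect_def)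
  have D_nonneg: "D y \<ge> 0" if "0 \<le> y" "y < n" for y
    using defect_nonneg[OF LYZ upper upper rf, of y "P' - 1"] that proper
    by (auto simp: D_def Z_def)
  show ?thesis
  proof (cases "z0 \<le> Z")
    case True
    then have pos: "defect Y y0 (Y - y0) 0 > 0" using y0 by (intro ex[OF _ reflects_box] box) auto
    then have YZ: "Y = 2" "Z = 0" using box_exceptional[OF ps fr box, of y0 z0] y0 True by auto
    have "D y = 0" if "0 \<le> y" "y < n" for y
    proof (rule ccontr)
      assume "D y \<noteq> 0"
      then have "D y > 0" using D_nonneg[OF that] by simp
      then have "P' - 1 = z0"
        using pseudo_symmetric_defect_unique(2)[OF ps fr upper upper rf _ box box reflects_box pos, of y "P' - 1" z0]
          that proper y0 True by (auto simp: D_def Z_def)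
      then show False using True proper by (simp add: Z_def)
    qed
    \<comment> \<open>This leaves \<open>s' = 2\<close>: for \<open>s' = 1\<close> it would read
      \<open>k - 1 = k - 2 - R\<close>.\<close>
    from this[of 0] have D0: "r (n - 1) = k - 2 - R" using n YZ r_0 r_2 by (simp add: D_eq)
    have "s' = 1 \<or> s' = 2" using YZ proper s'_less by (auto simp: Y_def)
    moreover have "s' \<noteq> 1"
    proof
      assume "s' = 1"
      then have "r 1 = k - 2 - R" using D0 YZ by (simp add: n_def Y_def)
      then show False using r_1 R by simp
    qed
    ultimately have "s' = 2" by simp
    moreover from this have "R = k - 2" using D0 YZ r_0 by (simp add: n_def Y_def)
    ultimately show ?thesis using YZ by (simp add: Y_def Z_def R_def)
  next
    case False
    have z0: "Z < z0" "z0 < P'" "y0 < n" using L0 False by (auto simp: L_def Z_def n_def)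
    \<comment> \<open>A failure in the box would be a second failing point.\<close>
    have dY: "k dvd Y - 1"
    proof (rule ccontr)
      assume "\<not> k dvd Y - 1"
      then have "defect Y 1 (Y - 1) 0 > 0" by (rule box_defect_one)
      moreover have "0 \<le> Z" using P_less by (simp add: Z_def)
      moreover have "defect Y y0 (n - 1 - y0) R > 0"
        using y0 z0 by (intro ex[OF _ rf] upper) (auto simp: Z_def)
      ultimately have "0 = z0"
        using pseudo_symmetric_defect_unique(2)[OF ps fr box box reflects_box _ upper upper rf, of 1 0 y0 z0]
          y0 z0 Y by (auto simp: Z_def)
      then show False using z0 \<open>0 \<le> Z\<close> by simp
    qed
    then have rY: "r Y = k - 1" using r_eq_pred_iff by simp
    have Dpos: "D y0 > 0"
      unfolding D_def using y0 z0 by (intro ex[OF _ rf] upper) (auto simp: Z_def)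
    have D_unique: "y = y0 \<and> z = z0" if "D y > 0" "0 \<le> y" "y < n" "Z < z" "z < P'" for y z
      using pseudo_symmetric_defect_unique[OF ps fr upper upper rf _ upper upper rf, of y z y0 z0]
        that y0 z0 Dpos by (auto simp: D_def Z_def)
    have selfdual: "2 * y0 = n - 1" and zz: "2 * z0 = 2 * P' - P - 1" and Dk: "D y0 = k"
      using pseudo_symmetric_defect_pos[OF ps fr upper upper rf, of y0 z0] y0 z0 Dpos
      by (auto simp: D_def Z_def)
    \<comment> \<open>The lowest row above the box fails at \<open>y0\<close> too, so
      \<open>z0\<close> is that row; by self-reflection it is also the middle row, whence
      \<open>P = 1\<close>.\<close>
    have "P' - P = z0"
      using D_unique[of y0 "P' - P"] Dpos y0 z0 proper by (simp add: Z_def)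
    then have P1: "P = 1" using zz by simp
    show ?thesis
    proof (cases "y0 = 0")
      case True
      then have "n = 1" using selfdual by simp
      then have "R = 2 * k - 1" using Dk True rY r_0 by (simp add: D_eq)
      then show ?thesis using P1 \<open>n = 1\<close> by (simp add: R_def n_def)
    next
      case False
      have "y0 = 1"
      proof (rule ccontr)
        assume "y0 \<noteq> 1"
        \<comment> \<open>This forces \<open>R = 0\<close> and \<open>n\<close> congruent to 2, and
          then \<open>r_add_pred\<close> makes the defect vanish at \<open>y0\<close> as
          well.\<close>
        then have "\<not> D 1 > 0" using D_unique[of 1 "P' - 1"] z0 selfdual y0 False proper by (auto simp: Z_def)
        then have "r (n - 2) + R \<le> 0" using rY r_1 by (simp add: D_eq)
        then have "R = 0" "r (n - 2) = 0" using R r_bounds[of "n - 2"] by auto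
        then have "k dvd y0 + (n - 1 - y0) - 1" using dvd_r[of "n - 2"] by simp
        then have "D y0 = 0" using r_add_pred rY \<open>R = 0\<close> by (simp add: D_eq)
        then show False using Dpos by simp
      qed
      then have "n = 3" using selfdual by simp
      then have "R = 1" using Dk \<open>y0 = 1\<close> rY r_1 by (simp add: D_eq)
      then show ?thesis using P1 \<open>n = 3\<close> by (simp add: R_def n_def)
    qed
  qed
qed

section \<open>Sufficient conditions at each corner\<close>

text \<open>The corner is \<open>(2, 0)\<close>, the failing point \<open>(1, 0)\<close>. Above the
  bottom row at most the column \<open>y = 0\<close> remains; the upper relation maps it to itself,
  and \<open>r 2 = k - 2\<close> cancels the correction.\<close>

lemma pseudo_symmetricI_box:
  assumes sh: "s = 3" "P' = P + 1" "P = 0 \<or> (s' = 2 \<and> k * \<tau>' - s' = k - 2)"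
  shows "pseudo_symmetric S"
proof (rule pseudo_symmetricI)
  show "(2, 0) \<in> L" "(1, 0) \<in> L" unfolding L_iff using sh P_nonneg by auto
  show "(2::int) \<ge> 1" by simp
  show "reflects 2 0 1 0 1 0 0" using reflects_box[of 2 0 1 0] by simp
  show "defect 2 1 1 0 = k" by (simp add: defect_def r_1 r_2)
  fix y z assume yz: "(y, z) \<in> L" "(y, z) \<noteq> (1, 0)"
  show "\<exists>y' z' \<rho>. (y', z') \<in> L \<and> reflects 2 0 y z y' z' \<rho> \<and> defect 2 y y' \<rho> \<le> 0"
  proof (cases "z = 0")
    case True
    then have "y = 0 \<or> y = 2" using yz sh unfolding L_iff by auto
    then have "defect 2 y (2 - y) 0 \<le> 0" by (auto simp: defect_def r_0)
    moreover have "(2 - y, 0) \<in> L" using yz True sh P_nonneg unfolding L_iff by auto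
    ultimately show ?thesis using reflects_box[of 2 0 y z] True by auto
  next
    case False
    then have *: "s' = 2" "k * \<tau>' - s' = k - 2" "y = 0" "0 < z" "z < P'"
      using yz sh unfolding L_iff by auto
    have "defect 2 y (2 - s' - y) (k * \<tau>' - s') \<le> 0"
      unfolding *(2) using *(1,3) by (simp add: defect_def r_0 r_2)
    moreover have "(2 - s' - y, 0 + P' - z) \<in> L" using * sh unfolding L_iff by auto
    ultimately show ?thesis using reflects_upper[of 2 0 y z] by blast
  qed
qed

text \<open>Both alternatives make \<open>Y\<close> congruent to 1 modulo \<open>k\<close>, so the
  box has no failures. One row is left beside it, with midpoint \<open>y0\<close>.\<close>

lemma pseudo_symmetricI_left:
  assumes sh: "P' = P + 1" "(s' = 1 \<and> s + k * \<tau> = 3) \<or> (s' = 2 * k - 1 \<and> s + k * \<tau> = 1)"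
  shows "pseudo_symmetric S"
proof -
  define Y Z R y0 where "Y = s - s' - 1" and "Z = P" and "R = s + k * \<tau>"
    and "y0 = (if s' = 1 then s - 1 else Y + k)"
  have nk: "2 * k - 1 \<noteq> 1" using k_ge by simp
  have dY: "k dvd Y - 1"
    using sh(2)
  proof
    assume "s' = 1 \<and> s + k * \<tau> = 3"
    then have "Y - 1 = k * (- \<tau>)" by (simp add: Y_def)
    then show ?thesis by simp
  next
    assume "s' = 2 * k - 1 \<and> s + k * \<tau> = 1"
    then have "Y - 1 = k * (- \<tau> - 2)" by (simp add: Y_def algebra_simps)
    then show ?thesis by simp
  qed
  have "Y \<ge> 0" using s'_less by (simp add: Y_def)
  moreover have "Y \<noteq> 0" using dY k_ge by auto
  ultimately have Y: "Y \<ge> 1" by simp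
  have rY: "r Y = k - 1" using dY r_eq_pred_iff by simp
  have rY1: "r (Y + 1) = k - 2" using r_cong[of "Y + 1" 2] dY r_2 by simp
  have L: "(y, z) \<in> L \<longleftrightarrow> 0 \<le> y \<and> 0 \<le> z \<and> (y \<le> Y \<and> z \<le> P \<or> Y < y \<and> y < s \<and> z = 0)" for y z
    unfolding L_iff Y_def using sh(1) P_nonneg s'_nonneg by auto
  have y0s: "Y < y0" "y0 < s" "s + Y - y0 = y0"
    using sh(2) k_ge nk by (auto simp: y0_def Y_def)
  have rf: "reflects Y Z y 0 (s + Y - y) 0 R" for y
    using reflects_right[of Y Z y 0] by (simp add: R_def Z_def)
  show ?thesis
  proof (rule pseudo_symmetricI)
    show "(Y, Z) \<in> L" using Y P_nonneg by (simp add: L Z_def)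
    show "Y \<ge> 1" by (rule Y)
    show "(y0, 0) \<in> L" using y0s Y by (simp add: L)
    show "reflects Y Z y0 0 y0 0 R" using rf[of y0] y0s by simp
    show "defect Y y0 y0 R = k"
    proof (cases "s' = 1")
      case True
      then have "y0 = Y + 1" by (simp add: y0_def Y_def)
      then show ?thesis using rY rY1 sh(2) True nk by (auto simp: defect_def R_def)
    next
      case False
      then have "r y0 = k - 1" using r_cong[of "Y + k" Y] rY by (simp add: y0_def)
      then show ?thesis using rY sh(2) False by (auto simp: defect_def R_def)
    qed
    fix y z assume yz: "(y, z) \<in> L" "(y, z) \<noteq> (y0, 0)"
    show "\<exists>y' z' \<rho>. (y', z') \<in> L \<and> reflects Y Z y z y' z' \<rho> \<and> defect Y y y' \<rho> \<le> 0"
    proof (cases "y \<le> Y")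
      case True
      then have "(Y - y, Z - z) \<in> L" using yz by (auto simp: L Z_def)
      then show ?thesis using reflects_box box_defect[OF dY, of y] by (metis order_refl)
    next
      case False
      then have y: "z = 0" "Y < y" "y < s" using yz by (auto simp: L)
      have "s' \<noteq> 1" using y yz by (auto simp: y0_def Y_def)
      then have s': "s' = 2 * k - 1" "R = 1" using sh(2) by (auto simp: R_def)
      have "defect Y y (s + Y - y) R \<le> 0"
      proof (rule ccontr)
        assume pos: "\<not> ?thesis"
        \<comment> \<open>Mirrored points of this row sum to \<open>2 * Y + 2 * k\<close>, congruent
          to 2. A positive defect pushes the sum of rounding amounts plus 2 up to
          \<open>2 * k\<close>, so \<open>y\<close> is congruent to \<open>Y\<close>, and only
          \<open>y0\<close> qualifies.\<close>
        have "k dvd (y + r y) + ((s + Y - y) + r (s + Y - y)) - 2 * (Y - 1) - 2 * k"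
          by (rule dvd_diff[OF dvd_diff[OF dvd_add[OF dvd_r dvd_r] dvd_mult[OF dY]] dvd_triv_right])
        moreover have "(y + r y) + ((s + Y - y) + r (s + Y - y)) - 2 * (Y - 1) - 2 * k = r y + r (s + Y - y) + 2"
          using s' by (simp add: Y_def)
        ultimately have dv: "k dvd r y + r (s + Y - y) + 2" by (simp only:)
        have "r y + r (s + Y - y) + 2 \<noteq> k" using pos rY s' by (simp add: defect_def)
        then have "\<not> r y + r (s + Y - y) + 2 < 2 * k"
          using dvd_eqI[OF dv] r_bounds[of y] r_bounds[of "s + Y - y"] by auto
        then have "r y = k - 1" using r_bounds[of y] r_bounds[of "s + Y - y"] by auto
        then have "k dvd y - 1" using r_eq_pred_iff by simp
        then have "k dvd y - Y" using dvd_diff[OF _ dY, of "y - 1"] by simp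
        then have "y - Y = k" using y s' by (intro dvd_eqI) (auto simp: Y_def)
        then show False using yz y \<open>s' \<noteq> 1\<close> by (simp add: y0_def)
      qed
      moreover have "(s + Y - y, 0) \<in> L" using y Y by (simp add: L)
      ultimately show ?thesis using rf[of y] y(1) by blast
    qed
  qed
qed

text \<open>Above the box lies the single row \<open>z = P' - 1\<close> of one or three points. In
  the latter case the outer pair has \<open>r 0 + r 2 = k - 2 = r Y - R\<close>.\<close>

lemma pseudo_symmetricI_upper:
  assumes sh: "P = 1" "k dvd s - 2"
    "(s = s' + 1 \<and> k * \<tau>' - s' = 2 * k - 1) \<or> (s = s' + 3 \<and> k * \<tau>' - s' = 1)"
  shows "pseudo_symmetric S"
proof -
  define Y Z R n where "Y = s - 1" and "Z = P' - 2" and "R = k * \<tau>' - s'" and "n = s - s'"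
  define y0 where "y0 = (n - 1) div 2"
  have nR: "n = 1 \<and> y0 = 0 \<and> R = 2 * k - 1 \<or> n = 3 \<and> y0 = 1 \<and> R = 1"
    using sh(3) by (auto simp: n_def R_def y0_def)
  have dY: "k dvd Y - 1" using sh(2) by (simp add: Y_def)
  have "Y \<ge> 0" using s'_less s'_nonneg by (simp add: Y_def)
  moreover have "Y \<noteq> 0" using dY k_ge by auto
  ultimately have Y: "Y \<ge> 1" by simp
  have rY: "r Y = k - 1" using dY r_eq_pred_iff by simp
  have L: "(y, z) \<in> L \<longleftrightarrow> 0 \<le> y \<and> 0 \<le> z \<and> (y \<le> Y \<and> z \<le> Z \<or> y < n \<and> z = P' - 1)" for y z
    unfolding L_iff Y_def Z_def n_def using sh(1) P_less s'_nonneg by auto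
  have rf: "reflects Y Z y (P' - 1) (n - 1 - y) (P' - 1) R" for y
    using reflects_upper[of Y Z y "P' - 1"] by (simp add: R_def Z_def Y_def n_def algebra_simps)
  have P': "P' \<ge> 2" using sh P_less by simp
  show ?thesis
  proof (rule pseudo_symmetricI)
    show "(Y, Z) \<in> L" using Y P' by (simp add: L Z_def)
    show "Y \<ge> 1" by (rule Y)
    show "(y0, P' - 1) \<in> L" using nR P' by (auto simp: L)
    show "reflects Y Z y0 (P' - 1) y0 (P' - 1) R" using rf[of y0] nR by auto
    show "defect Y y0 y0 R = k" using nR rY r_0 r_1 by (auto simp: defect_def)
    fix y z assume yz: "(y, z) \<in> L" "(y, z) \<noteq> (y0, P' - 1)"
    show "\<exists>y' z' \<rho>. (y', z') \<in> L \<and> reflects Y Z y z y' z' \<rho> \<and> defect Y y y' \<rho> \<le> 0"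
    proof (cases "z \<le> Z")
      case True
      then have "(Y - y, Z - z) \<in> L" using yz by (auto simp: L Z_def)
      then show ?thesis using reflects_box box_defect[OF dY, of y] by (metis order_refl)
    next
      case False
      then have y: "z = P' - 1" "0 \<le> y" "y < n" "y \<noteq> y0" using yz by (auto simp: L)
      then have "n = 3" "R = 1" "y = 0 \<or> y = 2" using nR by auto
      then have "defect Y y (n - 1 - y) R \<le> 0" using rY r_0 r_2 by (auto simp: defect_def)
      moreover have "(n - 1 - y, P' - 1) \<in> L" using y P' by (simp add: L)
      ultimately show ?thesis using rf[of y] y(1) by blast
    qed
  qed
qed

text \<open>Here \<open>a = 3\<close> and \<open>L\<close> is the row \<open>y = 0, 1, 2\<close>. As
  \<open>k \<ge> 2\<close>, one progression generator suffices for \<open>y = 1\<close> and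
  \<open>y = 2\<close>, just as for \<open>k = 2\<close> and \<open>c = 3\<close>.\<close>

lemma rectangle_eq:
  assumes "s = 3" "P = 0" "P' = 1"
  shows "S = semigroup_gen {3, 3 + d, 3 + 2 * d}"
proof -
  have a: "a = 3" using det assms by simp
  have "n \<in> S \<longleftrightarrow> n \<in> almost_arith 3 d 3 2" for n
  proof
    assume n: "n \<in> S"
    obtain y z t where yz: "(y, z) \<in> L" "n = a * t + d * y + c * z" by (rule rep)
    then have y: "0 \<le> y" "y \<le> 2" "z = 0" unfolding L_iff using assms by auto
    have "y \<le> k * t" using n S_rep_iff[OF yz(1)] ce_le_iff yz(2) by simp
    then have "0 \<le> k * t" "0 < y \<Longrightarrow> 0 < k * t" using y by auto
    then have "0 \<le> t" "0 < y \<Longrightarrow> 0 < t" using k_ge by (auto simp: zero_le_mult_iff zero_less_mult_iff)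
    then have "y \<le> 2 * t" using y by (cases "y = 0") auto
    moreover have "n = 3 * t + d * y + 3 * 0" using yz y a by simp
    ultimately show "n \<in> almost_arith 3 d 3 2"
      using y(1) \<open>0 \<le> t\<close> by (subst almost_arith_iff) (simp, blast)
  next
    assume "n \<in> almost_arith 3 d 3 2"
    then obtain t y z where *: "0 \<le> y" "y \<le> 2 * t" "0 \<le> t" "0 \<le> z" "n = 3 * t + d * y + 3 * z"
      using almost_arith_iff[of 2] by auto
    have "2 * t \<le> k * t" "0 \<le> k * z" using * k_ge by (auto intro: mult_right_mono)
    then have "y \<le> k * (t + z)" using * by (simp add: distrib_left)
    moreover have "n = a * (t + z) + d * y + c * 0" using * a by simp
    ultimately show "n \<in> S" using * S_iff by blast
  qed
  then show ?thesis using almost_arith_3 by blast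
qed

end

subsection \<open>The continued fraction\<close>

text \<open>Multiplication by \<open>d\<close> permutes the residues modulo \<open>a\<close>, so the
  \<open>THE\<close> is well defined.\<close>

lemma s0_of_props:
  assumes "a > 0" "coprime a d"
  shows "0 \<le> s0_of a d c" "s0_of a d c < a" "a dvd d * s0_of a d c - c"
proof -
  obtain y t where y: "0 \<le> y" "y < a" "c = a * t + d * y"
    using coprime_solve[OF assms(2,1)] .
  have "0 \<le> s0_of a d c \<and> s0_of a d c < a \<and> [d * s0_of a d c = c] (mod a)"
    unfolding s0_of_def
  proof (rule theI)
    show "0 \<le> y \<and> y < a \<and> [d * y = c] (mod a)" using y by (simp add: cong_def)
    fix x assume x: "0 \<le> x \<and> x < a \<and> [d * x = c] (mod a)"
    then have "[d * x = d * y] (mod a)" using y by (simp add: cong_def)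
    then have "[x = y] (mod a)"
      using cong_mult_lcancel[of d a x y] assms(2) by (simp add: coprime_commute)
    then show "x = y" using x y by (simp add: cong_def)
  qed
  then show "0 \<le> s0_of a d c" "s0_of a d c < a" "a dvd d * s0_of a d c - c"
    by (auto simp: cong_iff_dvd_diff)
qed

locale coprime_progression =
  fixes a d c k :: int
  assumes a_pos: "a > 0" and d_pos: "d > 0" and c_pos: "c > 0" and k_ge: "k \<ge> 2"
    and cop: "coprime a d"
begin

text \<open>Indices are shifted by one: \<open>u n\<close> and \<open>p n\<close> are $s_{n-1}$ and $P_{n-1}$.\<close>
definition "u n = fst (fst (sP_step a (s0_of a d c) n))"

definition "p n = fst (snd (sP_step a (s0_of a d c) n))"

lemma s_seq_eq: "s_seq a d c (int n - 1) = u n" and P_seq_eq: "P_seq a d c (int n - 1) = p n"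
  by (simp_all add: s_seq_def P_seq_def u_def p_def)

lemma step_eq: "sP_step a (s0_of a d c) n = ((u n, u (Suc n)), (p n, p (Suc n)))"
  by (simp add: u_def p_def Let_def split: prod.split)

lemma u_0: "u 0 = a" and p_0: "p 0 = 0" and p_1: "p (Suc 0) = 1"
  by (simp_all add: u_def p_def)

lemma u_Suc_Suc:
  "u (Suc (Suc n)) = (if u (Suc n) = 0 then 0 else (- u n) mod u (Suc n))"
  "u (Suc n) \<noteq> 0 \<Longrightarrow> \<exists>q. u (Suc (Suc n)) = q * u (Suc n) - u n \<and> p (Suc (Suc n)) = q * p (Suc n) - p n"
proof -
  define q where "q = (if u (Suc n) = 0 then 0 else - ((- u n) div u (Suc n)))"
  have "((u (Suc n), u (Suc (Suc n))), (p (Suc n), p (Suc (Suc n)))) = sP_step a (s0_of a d c) (Suc n)"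
    by (rule step_eq[symmetric])
  also have "\<dots> = ((u (Suc n), if u (Suc n) = 0 then 0 else q * u (Suc n) - u n), (p (Suc n), q * p (Suc n) - p n))"
    by (simp add: step_eq[of n] q_def Let_def)
  finally have eq: "u (Suc (Suc n)) = (if u (Suc n) = 0 then 0 else q * u (Suc n) - u n)"
    "p (Suc (Suc n)) = q * p (Suc n) - p n" by simp_all
  have "q * u (Suc n) - u n = (- u n) mod u (Suc n)" if "u (Suc n) \<noteq> 0"
    using that by (simp add: q_def minus_div_mult_eq_mod[symmetric])
  then show "u (Suc (Suc n)) = (if u (Suc n) = 0 then 0 else (- u n) mod u (Suc n))"
    using eq by simp
  show "\<exists>q. u (Suc (Suc n)) = q * u (Suc n) - u n \<and> p (Suc (Suc n)) = q * p (Suc n) - p n"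
    if "u (Suc n) \<noteq> 0" using eq that by auto
qed

lemma u_nonneg: "u n \<ge> 0" and u_zero: "u n = 0 \<Longrightarrow> u (Suc n) = 0"
proof -
  have u1: "0 \<le> u (Suc 0)" using s0_of_props[OF a_pos cop] by (simp add: u_def)
  have "0 \<le> u n \<and> 0 \<le> u (Suc n) \<and> (u n = 0 \<longrightarrow> u (Suc n) = 0)"
  proof (induction n)
    case 0
    then show ?case using u_0 a_pos u1 by simp
  next
    case (Suc n)
    then show ?case using u_Suc_Suc(1)[of n] by auto
  qed
  then show "u n \<ge> 0" "u n = 0 \<Longrightarrow> u (Suc n) = 0" by auto
qed

text \<open>\<open>u\<close> and \<open>p\<close> obey the same linear recursion, which preserves
  the determinant and the congruences. The decrease of \<open>u\<close> forces
  \<open>q \<ge> 2\<close>, so \<open>p\<close> grows; \<open>int n \<le> p n\<close> later recovers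
  the index from $P_v = 1$.\<close>

lemma invariants:
  "u n > 0 \<Longrightarrow> u (Suc n) < u n \<and> int n \<le> p n \<and> p n < p (Suc n) \<and>
    u n * p (Suc n) - u (Suc n) * p n = a \<and>
    a dvd d * u n - c * p n \<and> a dvd d * u (Suc n) - c * p (Suc n)"
proof (induction n)
  case 0
  have "u (Suc 0) = s0_of a d c" by (simp add: u_def)
  then show ?case using s0_of_props[OF a_pos cop] by (simp add: u_0 p_0 p_1)
next
  case (Suc n)
  then have "u n > 0" using u_nonneg[of n] u_zero[of n] by force
  note IH = Suc.IH[OF this]
  obtain q where q: "u (Suc (Suc n)) = q * u (Suc n) - u n" "p (Suc (Suc n)) = q * p (Suc n) - p n"
    using u_Suc_Suc(2)[of n] Suc.prems by auto
  have "1 * u (Suc n) < q * u (Suc n)" using q(1) u_nonneg[of "Suc (Suc n)"] IH by linarith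
  then have "q \<ge> 2" using Suc.prems by simp
  have "p (Suc n) \<ge> 0" using IH by linarith
  then have "2 * p (Suc n) \<le> q * p (Suc n)" using \<open>q \<ge> 2\<close> by (intro mult_right_mono)
  then have "p (Suc n) < p (Suc (Suc n))" using q(2) IH by linarith
  moreover have "u (Suc (Suc n)) < u (Suc n)" using u_Suc_Suc(1)[of n] Suc.prems by simp
  moreover have "u (Suc n) * p (Suc (Suc n)) - u (Suc (Suc n)) * p (Suc n) = a"
    using IH unfolding q by (simp add: algebra_simps)
  moreover have "d * u (Suc (Suc n)) - c * p (Suc (Suc n))
      = q * (d * u (Suc n) - c * p (Suc n)) - (d * u n - c * p n)"
    unfolding q by (simp add: algebra_simps)
  then have "a dvd d * u (Suc (Suc n)) - c * p (Suc (Suc n))"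
    using IH by (metis dvd_diff dvd_mult)
  ultimately show ?case using IH by auto
qed

section \<open>The sequence $R_i$ and the index $v$\<close>

definition "R n = R_seq a d c k (int n - 1)"

text \<open>The numerator is \<open>a * (u n + k * \<tau>)\<close>, so the division in
  \<open>R_seq\<close> is exact.\<close>

lemma R_eq:
  assumes "d * u n - c * p n = a * \<tau>" shows "R n = u n + k * \<tau>"
proof -
  have "(a + k * d) * u n - k * c * p n = a * u n + k * (d * u n - c * p n)"
    by (simp add: algebra_simps)
  also have "\<dots> = a * (u n + k * \<tau>)" unfolding assms by (simp add: algebra_simps)
  finally show ?thesis using a_pos by (simp add: R_def R_seq_def s_seq_eq P_seq_eq)
qed

lemma a_R:
  assumes "a dvd d * u n - c * p n"
  shows "a * R n = (a + k * d) * u n - k * c * p n"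
proof -
  obtain \<tau> where \<tau>: "d * u n - c * p n = a * \<tau>" using assms by blast
  have "(a + k * d) * u n - k * c * p n = a * u n + k * (d * u n - c * p n)"
    by (simp add: algebra_simps)
  also have "\<dots> = a * (u n + k * \<tau>)" unfolding \<tau> by (simp add: algebra_simps)
  finally show ?thesis using R_eq[OF \<tau>] by simp
qed

lemma R_decreasing:
  assumes "u n > 0" shows "R (Suc n) < R n"
proof -
  note I = invariants[OF assms]
  have "a * R (Suc n) = (a + k * d) * u (Suc n) - k * c * p (Suc n)" using I by (intro a_R) simp
  also have "(a + k * d) * u (Suc n) < (a + k * d) * u n"
    using I a_pos d_pos k_ge by (simp add: add_pos_pos)
  then have "(a + k * d) * u (Suc n) - k * c * p (Suc n) < (a + k * d) * u n - k * c * p n"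
  proof -
    have "k * c * p n \<le> k * c * p (Suc n)" using I c_pos k_ge by simp
    then show ?thesis using \<open>(a + k * d) * u (Suc n) < (a + k * d) * u n\<close> by linarith
  qed
  also have "\<dots> = a * R n" using I by (intro a_R[symmetric]) simp
  finally show ?thesis using a_pos by simp
qed

lemma shape:
  assumes "u n > 0" "R n > 0" "R (Suc n) \<le> 0"
  obtains \<tau> \<tau>' where "rodseth_shape a d c k (u n) (u (Suc n)) (p n) (p (Suc n)) \<tau> \<tau>'"
    "R n = u n + k * \<tau>" "- R (Suc n) = k * \<tau>' - u (Suc n)"
proof -
  note I = invariants[OF assms(1)]
  obtain \<tau> \<tau>' where \<tau>: "d * u n - c * p n = a * \<tau>" "d * u (Suc n) - c * p (Suc n) = a * \<tau>'"
    using I by (meson dvdE)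
  note R = R_eq[OF \<tau>(1)] R_eq[OF \<tau>(2)]
  \<comment> \<open>The second relation of the locale has the opposite orientation, hence the sign
    of \<open>\<tau>'\<close>.\<close>
  have "rodseth_shape a d c k (u n) (u (Suc n)) (p n) (p (Suc n)) \<tau> (- \<tau>')"
    using a_pos d_pos c_pos k_ge cop I u_nonneg[of "Suc n"] \<tau> R assms
    by unfold_locales auto
  then show ?thesis using that R by simp
qed

text \<open>Strict decrease brings \<open>u\<close> to 0 within \<open>a\<close> steps, and up to
  that index \<open>R\<close> decreases strictly from a positive to a negative value. So both
  \<open>m_idx\<close> and \<open>v_idx\<close> are well defined.\<close>

lemma v_idx_eq:
  obtains n where "v_idx a d c k = int n - 1" "u n > 0" "R n > 0" "R (Suc n) \<le> 0"
proof -
  have "int n + u n \<le> a" if "u n > 0" for n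
    using that
  proof (induction n)
    case 0
    then show ?case by (simp add: u_0)
  next
    case (Suc n)
    then have "u n > 0" using u_nonneg[of n] u_zero[of n] by force
    then show ?case using Suc.IH invariants[of n] by simp
  qed
  from this[of "nat a"] have ex: "u (nat a) = 0" using u_nonneg[of "nat a"] a_pos by force
  define N where "N = (LEAST n. u n = 0)"
  have uN: "u N = 0" unfolding N_def using ex by (rule LeastI)
  have uless: "u n > 0" if "n < N" for n
    using not_less_Least[of n "\<lambda>n. u n = 0"] that u_nonneg[of n] by (simp add: N_def)
  have uge: "u n = 0" if "n \<ge> N" for n
    using that by (induction n rule: dec_induct) (auto simp: uN u_zero)
  have "N \<noteq> 0" using uN u_0 a_pos by (metis less_irrefl)
  have nat_ind: "\<exists>n. i = int n - 1" if "i \<ge> -1" for i using that by (intro exI[of _ "nat (i + 1)"]) simp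
  have s_Suc: "s_seq a d c (int n - 1 + 1) = u (Suc n)" for n
    using s_seq_eq[of "Suc n"] by simp
  \<comment> \<open>\<open>u N\<close> is $s_{N-1}$, and it is the first zero $s_{m+1}$.\<close>
  have m: "m_idx a d c = int N - 2"
    unfolding m_idx_def
  proof (rule the_equality)
    show "- 1 \<le> int N - 2 \<and> s_seq a d c (int N - 2 + 1) = 0 \<and>
        (\<forall>i. - 1 \<le> i \<and> i \<le> int N - 2 \<longrightarrow> 0 < s_seq a d c i)"
    proof (intro conjI allI impI)
      show "- 1 \<le> int N - 2" using \<open>N \<noteq> 0\<close> by simp
      show "s_seq a d c (int N - 2 + 1) = 0" using s_seq_eq[of N] uN by simp
      fix i assume i: "- 1 \<le> i \<and> i \<le> int N - 2"
      then obtain n where "i = int n - 1" using nat_ind by blast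
      then show "0 < s_seq a d c i" using s_seq_eq[of n] uless[of n] i by simp
    qed
  next
    fix m assume h: "- 1 \<le> m \<and> s_seq a d c (m + 1) = 0 \<and> (\<forall>i. - 1 \<le> i \<and> i \<le> m \<longrightarrow> 0 < s_seq a d c i)"
    then obtain n where n: "m = int n - 1" using nat_ind by blast
    have "u (Suc n) = 0" using h n s_Suc[of n] by simp
    moreover have "0 < s_seq a d c m" using h by auto
    then have "u n > 0" using n s_seq_eq[of n] by simp
    ultimately have "n < N" "\<not> Suc n < N" using uge[of n] uless[of "Suc n"] by force+
    then show "m = int N - 2" using n by simp
  qed
  have "R N < 0"
  proof -
    obtain N' where N': "N = Suc N'" using \<open>N \<noteq> 0\<close> not0_implies_Suc by blast
    note I = invariants[OF uless, of N', unfolded N', simplified]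
    have "a * R N = (a + k * d) * u N - k * c * p N" using I N' by (intro a_R) simp
    also have "\<dots> < 0" using uN I N' c_pos k_ge by simp
    finally show ?thesis using a_pos by (simp add: mult_less_0_iff)
  qed
  have "R 0 > 0"
  proof -
    have "a * R 0 = (a + k * d) * a" using a_R[of 0] by (simp add: u_0 p_0)
    then show ?thesis using a_pos d_pos k_ge by (simp add: add_pos_pos)
  qed
  define n1 where "n1 = (LEAST n. R n \<le> 0)"
  have n1: "R n1 \<le> 0"
    unfolding n1_def using LeastI[of "\<lambda>n. R n \<le> 0" N] \<open>R N < 0\<close> by simp
  have "n1 \<le> N"
    unfolding n1_def using Least_le[of "\<lambda>n. R n \<le> 0" N] \<open>R N < 0\<close> by simp
  have "n1 \<noteq> 0" using n1 \<open>R 0 > 0\<close> by (metis not_less)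
  then obtain n where n: "n1 = Suc n" using not0_implies_Suc by blast
  have below: "R i > 0" if "i < n1" for i
    using not_less_Least[of i "\<lambda>n. R n \<le> 0"] that by (simp add: n1_def)
  have above: "R i \<le> 0" if "n1 \<le> i" "i \<le> N" for i
    using that
  proof (induction i rule: dec_induct)
    case base
    show ?case by (rule n1)
  next
    case (step i)
    then show ?case using R_decreasing[OF uless, of i] by simp
  qed
  have RR: "R_seq a d c k (int n - 1) = R n" "R_seq a d c k (int n - 1 + 1) = R (Suc n)" for n
    by (simp_all add: R_def)
  have "v_idx a d c k = int n - 1"
    unfolding v_idx_def m
  proof (rule the_equality)
    show "- 1 \<le> int n - 1 \<and> int n - 1 \<le> int N - 2 \<and> R_seq a d c k (int n - 1 + 1) \<le> 0 \<and>
        0 < R_seq a d c k (int n - 1)"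
      unfolding RR using n n1 below \<open>n1 \<le> N\<close> by simp
  next
    fix v assume v: "- 1 \<le> v \<and> v \<le> int N - 2 \<and> R_seq a d c k (v + 1) \<le> 0 \<and> 0 < R_seq a d c k v"
    then obtain l where l: "v = int l - 1" using nat_ind by blast
    have "R (Suc l) \<le> 0" "0 < R l" "l < N" using v unfolding l RR by auto
    then have "\<not> Suc l < n1" "\<not> n1 \<le> l" using below[of "Suc l"] above[of l] by force+
    then show "v = int n - 1" using l n by simp
  qed
  then show ?thesis using that[of n] n n1 below uless[of n] \<open>n1 \<le> N\<close> by simp
qed

text \<open>If $R_0 \le 0$ then \<open>d = 1\<close> and \<open>a < k\<close>, hence $s_0 = 2$ and $P_1 (2 - R_0) = k$, although \<open>k\<close>
  divides $2 - R_0$ and $P_1 \ge 2$.\<close>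
lemma R0_pos:
  assumes s0: "u 1 > 0" and "k dvd u 1 - 2"
    and "(u 1 = u 2 + 1 \<and> R 2 = 1 - 2 * k) \<or> (u 1 = u 2 + 3 \<and> R 2 = -1)"
  shows "R 1 > 0"
proof -
  have u2: "Suc 1 = 2" by simp
  note I = invariants[OF s0, unfolded u2]
  have p1: "p 1 = 1" using p_1 by simp
  define q where "q = p 2"
  have q: "q \<ge> 2" using I p1 by (simp add: q_def)
  have det: "u 1 * q - u 2 = a" using I p1 by (simp add: q_def)
  have R1: "a * R 1 = (a + k * d) * u 1 - k * c" using a_R[of 1] I p1 by simp
  have R2: "a * R 2 = (a + k * d) * u 2 - k * c * q" using a_R[of 2] I by (simp add: q_def)
  \<comment> \<open>The determinant eliminates \<open>c\<close> between \<open>R 1\<close> and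
    \<open>R 2\<close>, which are $R_0$ and $R_1$; \<open>q\<close> is $P_1$.\<close>
  have "a * (q * R 1 - R 2) = q * (a * R 1) - a * R 2" by (simp add: algebra_simps)
  also have "\<dots> = (a + k * d) * (u 1 * q - u 2)" unfolding R1 R2 by (simp add: algebra_simps)
  also have "\<dots> = a * (a + k * d)" unfolding det by simp
  finally have qR: "q * R 1 - R 2 = a + k * d" using a_pos by simp
  have kd: "k \<le> k * d" using k_ge d_pos by simp
  show ?thesis
  proof (rule ccontr)
    assume neg: "\<not> R 1 > 0"
    then have "q * R 1 \<le> 0" using q by (simp add: mult_le_0_iff)
    then have "a + k * d \<le> - R 2" using qR by simp
    then have e: "u 1 = u 2 + 1" "R 2 = 1 - 2 * k" and le: "a + k * d \<le> 2 * k - 1"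
      using assms(3) kd a_pos k_ge by auto
    have "k * d < k * 2" using le a_pos by simp
    then have d1: "d = 1" using k_ge d_pos by simp
    have "u 1 < a" using invariants[of 0] u_0 a_pos by simp
    then have "u 1 - 2 < k" using le d1 by simp
    have "u 1 = 2"
    proof (rule ccontr)
      assume "u 1 \<noteq> 2"
      then have "\<bar>k\<bar> \<le> \<bar>u 1 - 2\<bar>" using assms(2) by (intro dvd_imp_le_int) auto
      then show False using \<open>u 1 - 2 < k\<close> k_ge s0 by auto
    qed
    then have "q * (2 - R 1) = k" using e det qR d1 by (simp add: algebra_simps)
    obtain \<tau> where \<tau>: "d * u 1 - c * p 1 = a * \<tau>" using I by blast
    have "2 - R 1 = k * (- \<tau>)" using R_eq[OF \<tau>] \<open>u 1 = 2\<close> by simp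
    then have "k dvd 2 - R 1" by (simp only: dvd_triv_left)
    then have "k \<le> 2 - R 1" using neg by (intro zdvd_imp_le) auto
    then have "2 * k \<le> q * (2 - R 1)" using q k_ge by (intro mult_mono) auto
    then show False using \<open>q * (2 - R 1) = k\<close> k_ge by simp
  qed
qed

end

subsection \<open>The classification\<close>

lemma semigroup_gen_dvd:
  assumes "\<And>b. b \<in> B \<Longrightarrow> h dvd b" "x \<in> semigroup_gen B"
  shows "h dvd x"
  using assms(2) by induction (simp_all add: assms(1))

text \<open>The generators fit \<open>c = 3\<close>, \<open>k = 2\<close>, with a shape supplied by
  hand: a row of three points.\<close>

lemma pseudo_symmetric_3:
  assumes "d > 0" "coprime 3 d"
  shows "pseudo_symmetric (semigroup_gen {3, 3 + d, 3 + 2 * d})"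
proof -
  interpret rodseth_shape 3 d 3 2 3 0 0 1 d 1
    using assms by unfold_locales auto
  show ?thesis using pseudo_symmetricI_box almost_arith_3 by simp
qed

text \<open>For \<open>c = 2 * e + 1\<close> the equation reads
  \<open>a * e = 2 * e + 1 + d\<close>. This yields explicit relations, so the shape is written down
  directly instead of being read off the continued fraction.\<close>

lemma pseudo_symmetric_three_generated:
  assumes "a > 0" "d > 0" "c > 0" "k \<ge> 2" "coprime a d" "a * (c - 1) = 2 * (c + d)" "odd c"
  shows "pseudo_symmetric (almost_arith a d c k)"
proof -
  obtain e where c: "c = 2 * e + 1" using assms(7) by (rule oddE)
  have ae: "a * e = 2 * e + 1 + d" using assms(6) by (simp add: c)
  have "e \<noteq> 0" using ae assms(2) by auto
  then have e: "e \<ge> 1" using assms(3) c by simp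
  have "a * e > 2 * e" using ae assms(2) by simp
  then have a: "a > 2" using e by simp
  have ke: "k * (e - 1) \<ge> 0" using e assms(4) by simp
  have *: "c * a = 2 * (a * e) + a" "c * 2 = 4 * e + 2" by (simp_all add: c algebra_simps)
  interpret rodseth_shape a d c k 3 2 "a - 3" "a - 2" "e - 1" 1
  proof unfold_locales
    have "c * (a - 3) + a * (e - 1) = c * a - 3 * c + a * e - a" by (simp add: algebra_simps)
    then show "d * 3 = c * (a - 3) + a * (e - 1)" using * ae c by simp
    have "c * (a - 2) = c * a - c * 2" by (simp add: algebra_simps)
    then show "c * (a - 2) = d * 2 + a * 1" using * ae by simp
    show "0 < 3 + k * (e - 1)" using ke by linarith
  qed (use assms a in auto)
  show ?thesis by (rule pseudo_symmetricI_box) auto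
qed

text \<open>The last assumption means \<open>\<tau>' = 1\<close>. The second relation then becomes
  the equation, and the first makes \<open>c - 1\<close> equal to
  \<open>2 * (\<tau> + 1)\<close>.\<close>

lemma (in rodseth_shape) three_generatedD:
  assumes "s = 3" "s' = 2" "P' = P + 1" "k * \<tau>' - s' = k - 2"
  shows "a * (c - 1) = 2 * (c + d)" "odd c"
proof -
  have "k * (\<tau>' - 1) = 0" using assms by (simp add: algebra_simps)
  then have \<tau>': "\<tau>' = 1" using k_ge by simp
  have P: "P = a - 3" "P' = a - 2" using det assms by auto
  have 2: "c * a - 2 * c = 2 * d + a" using rel' assms \<tau>' P by (simp add: algebra_simps)
  then show eq: "a * (c - 1) = 2 * (c + d)" by (simp add: algebra_simps)
  have "3 * d = c * a - 3 * c + a * \<tau>" using rel assms P by (simp add: algebra_simps)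
  then have "c + d = a * (\<tau> + 1)" using 2 by (simp add: algebra_simps)
  then have "a * (c - 1) = a * (2 * (\<tau> + 1))" using eq by simp
  then have "c - 1 = 2 * (\<tau> + 1)" using a_pos by simp
  then have "c = 2 * (\<tau> + 1) + 1" by simp
  then show "odd c" by simp
qed

theorem theorem7:
  fixes a d c k :: int
  assumes "a > 0" and "d > 0" and "c > 0" and "k \<ge> 2"
    and "Gcd (insert c {a + j * d | j. 0 \<le> j \<and> j \<le> k}) = 1"
  shows "pseudo_symmetric (semigroup_gen (insert c {a + j * d | j. 0 \<le> j \<and> j \<le> k}))
    \<longleftrightarrow> gcd a d = 1 \<and>
      (let S = semigroup_gen (insert c {a + j * d | j. 0 \<le> j \<and> j \<le> k});
           s = s_seq a d c; P = P_seq a d c; R = R_seq a d c k; v = v_idx a d c k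
       in S = semigroup_gen {3, 3 + d, 3 + 2 * d}
        \<or> (a * (c - 1) = 2 * (c + d) \<and> odd c)
        \<or> ([s v = 3] (mod k) \<and> s (v + 1) = 1 \<and> P (v + 1) = P v + 1 \<and> R v = 3)
        \<or> ([s v = 1] (mod k) \<and> s (v + 1) = 2 * k - 1 \<and> P (v + 1) = P v + 1 \<and> R v = 1)
        \<or> (s 0 > 0 \<and> [s 0 = 2] (mod k) \<and> s 0 = s 1 + 1 \<and> R 1 = 1 - 2 * k)
        \<or> (s 0 > 0 \<and> [s 0 = 2] (mod k) \<and> s 0 = s 1 + 3 \<and> R 1 = -1))"
    (is "?ps \<longleftrightarrow> _ \<and> ?conds")
proof -
  let ?B = "insert c {a + j * d | j. 0 \<le> j \<and> j \<le> k}"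
  have unit: "is_unit h" if "\<And>b. b \<in> ?B \<Longrightarrow> h dvd b" for h :: int
  proof -
    have "h dvd Gcd ?B" by (rule Gcd_greatest) (rule that)
    then show ?thesis by (simp only: assms(5))
  qed
  have "is_unit (gcd (gcd a d) c)" by (rule unit) (auto simp: gcd_dvdI1 gcd_dvdI2)
  then have gc: "coprime (gcd a d) c" by (simp add: coprime_iff_gcd_eq_1)
  have equiv: "?ps \<longleftrightarrow> ?conds" if cop: "coprime a d"
  proof -
    interpret coprime_progression a d c k using assms cop by unfold_locales
    obtain n where n: "v_idx a d c k = int n - 1" "u n > 0" "R n > 0" "R (Suc n) \<le> 0"
      by (rule v_idx_eq)
    \<comment> \<open>Indices are one larger than in the statement: \<open>u 1\<close>,
      \<open>u 2\<close>, \<open>R 2\<close> are $s_0$, $s_1$, $R_1$.\<close>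
    have ix: "s_seq a d c (v_idx a d c k) = u n" "s_seq a d c (v_idx a d c k + 1) = u (Suc n)"
      "P_seq a d c (v_idx a d c k) = p n" "P_seq a d c (v_idx a d c k + 1) = p (Suc n)"
      "R_seq a d c k (v_idx a d c k) = R n"
      "s_seq a d c 0 = u 1" "s_seq a d c 1 = u 2" "R_seq a d c k 1 = R 2"
      using s_seq_eq[of n] s_seq_eq[of "Suc n"] P_seq_eq[of n] P_seq_eq[of "Suc n"]
        s_seq_eq[of 1] s_seq_eq[of 2] by (simp_all add: n(1) R_def)
    have conds: "?conds \<longleftrightarrow> almost_arith a d c k = semigroup_gen {3, 3 + d, 3 + 2 * d}
        \<or> (a * (c - 1) = 2 * (c + d) \<and> odd c)
        \<or> (k dvd u n - 3 \<and> u (Suc n) = 1 \<and> p (Suc n) = p n + 1 \<and> R n = 3)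
        \<or> (k dvd u n - 1 \<and> u (Suc n) = 2 * k - 1 \<and> p (Suc n) = p n + 1 \<and> R n = 1)
        \<or> (u 1 > 0 \<and> k dvd u 1 - 2 \<and> u 1 = u 2 + 1 \<and> R 2 = 1 - 2 * k)
        \<or> (u 1 > 0 \<and> k dvd u 1 - 2 \<and> u 1 = u 2 + 3 \<and> R 2 = -1)" (is "_ \<longleftrightarrow> ?C")
      unfolding Let_def ix cong_iff_dvd_diff by (rule refl)
    obtain \<tau> \<tau>' where sh: "rodseth_shape a d c k (u n) (u (Suc n)) (p n) (p (Suc n)) \<tau> \<tau>'"
      and Rn: "R n = u n + k * \<tau>" "- R (Suc n) = k * \<tau>' - u (Suc n)"
      using shape[OF n(2-4)] .
    interpret sh: rodseth_shape a d c k "u n" "u (Suc n)" "p n" "p (Suc n)" \<tau> \<tau>' by (rule sh)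
    have necessary: "?C" if ps: ?ps
    proof (cases "p n = 0 \<or> u (Suc n) = 0")
      case True
      then show ?thesis
        using sh.rectangle_eq[OF sh.pseudo_symmetric_rectangle[OF ps True]] by blast
    next
      case False
      then have proper: "p n > 0" "u (Suc n) > 0" using sh.P_nonneg sh.s'_nonneg by auto
      from sh.frobenius_corner show ?thesis
      proof
        assume "frobenius sh.S = sh.frob (u n - u (Suc n) - 1) (p (Suc n) - 1)"
        note A = sh.pseudo_symmetric_left_corner[OF ps proper this]
        \<comment> \<open>$s_v$ and $R_v$ agree modulo \<open>k\<close>, so the value of $R_v$ gives
          the congruence.\<close>
        have "k dvd u n - R n" using Rn(1) by simp
        then have "R n = 3 \<Longrightarrow> k dvd u n - 3" "R n = 1 \<Longrightarrow> k dvd u n - 1" by (simp_all only:)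
        then show ?thesis using A(1) A(2)[folded Rn(1)] by blast
      next
        assume "frobenius sh.S = sh.frob (u n - 1) (p (Suc n) - p n - 1)"
        note B = sh.pseudo_symmetric_right_corner[OF ps proper this]
        show ?thesis
        proof (cases "p n = 1")
          case True
          \<comment> \<open>Since \<open>p n\<close> is at least \<open>n\<close>, $P_v = 1$ means
            $v = 0$, and conditions on $s_v$ become conditions on $s_0$.\<close>
          then have "n = 1" using invariants[OF n(2)] p_0 by (cases n) auto
          then have "2 = Suc n" by simp
          from B consider "u n = 3 \<and> u (Suc n) = 2 \<and> p (Suc n) = p n + 1 \<and> k * \<tau>' - u (Suc n) = k - 2"
            | "u n = u (Suc n) + 1 \<and> k * \<tau>' - u (Suc n) = 2 * k - 1"
            | "u n = u (Suc n) + 3 \<and> k * \<tau>' - u (Suc n) = 1" by blast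
          then show ?thesis
          proof cases
            case 1
            then show ?thesis using sh.three_generatedD by blast
          next
            case 2
            then have "u n - 2 = k * (\<tau>' - 2)" by (simp add: algebra_simps)
            then have "k dvd u n - 2" by (simp only: dvd_triv_left)
            then show ?thesis using 2 Rn(2) n(2) unfolding \<open>2 = Suc n\<close> \<open>n = 1\<close> by simp
          next
            case 3
            then have "u n - 2 = k * \<tau>'" by (simp add: algebra_simps)
            then have "k dvd u n - 2" by (simp only: dvd_triv_left)
            then show ?thesis using 3 Rn(2) n(2) unfolding \<open>2 = Suc n\<close> \<open>n = 1\<close> by simp
          qed
        next
          case False
          \<comment> \<open>Only the failing point in the box is left, which is condition
            (b).\<close>
          then show ?thesis using B sh.three_generatedD by blast
        qed
      qed
    qed
    \<comment> \<open>Conditions (e) and (f) concern index 0 rather than $v$. \<open>R0_pos\<close>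
      places the sign change of \<open>R\<close> there, which provides the shape at that
      index.\<close>
    have upper: ?ps if ef: "u 1 > 0" "k dvd u 1 - 2"
      "(u 1 = u 2 + 1 \<and> R 2 = 1 - 2 * k) \<or> (u 1 = u 2 + 3 \<and> R 2 = -1)"
    proof -
      have two: "2 = Suc 1" by simp
      have R: "R 1 > 0" "R (Suc 1) \<le> 0" using R0_pos[OF ef] ef(3) k_ge by (auto simp: two)
      obtain \<pi> \<pi>' where "rodseth_shape a d c k (u 1) (u (Suc 1)) (p 1) (p (Suc 1)) \<pi> \<pi>'"
        and R2: "- R (Suc 1) = k * \<pi>' - u (Suc 1)"
        using shape[OF ef(1) R] by blast
      then interpret s1: rodseth_shape a d c k "u 1" "u (Suc 1)" "p 1" "p (Suc 1)" \<pi> \<pi>' by simp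
      have "(u 1 = u (Suc 1) + 1 \<and> - R (Suc 1) = 2 * k - 1) \<or> (u 1 = u (Suc 1) + 3 \<and> - R (Suc 1) = 1)"
        using ef(3) by (auto simp: two)
      then show ?ps using s1.pseudo_symmetricI_upper[OF _ ef(2)] p_1 unfolding R2 by simp
    qed
    have sufficient: ?ps if ?C
      using that
    proof (elim disjE)
      assume S: "almost_arith a d c k = semigroup_gen {3, 3 + d, 3 + 2 * d}"
      \<comment> \<open>Coprimality of 3 and \<open>d\<close> has to be recovered from the equality
        of sets: \<open>gcd 3 d\<close> divides every original generator.\<close>
      have "is_unit (gcd 3 d)"
      proof (rule unit)
        fix b assume "b \<in> ?B"
        then have "b \<in> semigroup_gen {3, 3 + d, 3 + 2 * d}"
          using semigroup_gen_mult[of b ?B 1] S by simp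
        then show "gcd 3 d dvd b" by (rule semigroup_gen_dvd[rotated]) auto
      qed
      then have "coprime 3 d" by (simp add: coprime_iff_gcd_eq_1)
      then show ?ps using pseudo_symmetric_3 assms(2) S by simp
    next
      assume "a * (c - 1) = 2 * (c + d) \<and> odd c"
      then show ?ps using pseudo_symmetric_three_generated assms cop by blast
    next
      assume "k dvd u n - 3 \<and> u (Suc n) = 1 \<and> p (Suc n) = p n + 1 \<and> R n = 3"
      then show ?ps using sh.pseudo_symmetricI_left Rn by simp
    next
      assume "k dvd u n - 1 \<and> u (Suc n) = 2 * k - 1 \<and> p (Suc n) = p n + 1 \<and> R n = 1"
      then show ?ps using sh.pseudo_symmetricI_left Rn by simp
    next
      assume "u 1 > 0 \<and> k dvd u 1 - 2 \<and> u 1 = u 2 + 1 \<and> R 2 = 1 - 2 * k"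
      then show ?ps using upper by blast
    next
      assume "u 1 > 0 \<and> k dvd u 1 - 2 \<and> u 1 = u 2 + 3 \<and> R 2 = -1"
      then show ?ps using upper by blast
    qed
    show ?thesis unfolding conds using necessary sufficient by (rule iffI)
  qed
  show ?thesis
  proof (cases "coprime a d")
    case True
    then show ?thesis using equiv by (simp only: coprime_iff_gcd_eq_1) simp
  next
    case False
    have "k \<ge> 1" using assms(4) by simp
    then have "\<not> ?ps"
      using almost_arith_pseudo_symmetric_coprime[OF assms(1-3) _ gc] False by blast
    then show ?thesis using False by (simp add: coprime_iff_gcd_eq_1)
  qed
qed

end
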